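(* Let $n\ge 1$, let $\mathcal{E}$ be a Hilbert space, and let $L\in\mathcal{B}(\mathcal{E},\mathcal{F}_n^2\otimes\mathcal{E})$ be a symbol with odometer map $W_L\in\mathcal{B}(\mathcal{F}_n^2\otimes\mathcal{E})$. With respect to the orthogonal decompositions $\mathcal{F}_n^2\otimes\mathcal{E}=\mathcal{N}\oplus\mathcal{N}^\perp$ (domain) and $\mathcal{F}_n^2\otimes\mathcal{E}=\mathcal{M}\oplus\mathcal{M}^\perp$ (codomain), the odometer map admits the block decomposition $$W_L=\begin{pmatrix}W_{11}&W_{12}\\0&W_{22}\end{pmatrix},$$ where $W_{11}=W_L|_{\mathcal{N}}$, $W_{12}=P_{\mathcal{M}}W_L|_{\mathcal{N}^\perp}$, $W_{22}=P_{\mathcal{M}^\perp}W_L|_{\mathcal{N}^\perp}$, and: (1) $W_{11}:\mathcal{N}\to\mathcal{M}$ is unitary; (2) $W_{12}:\mathcal{N}^\perp\to\mathcal{M}$ is either zero or has infinite rank; (3) the Toeplitz-type realization $W_{22}V\in\mathcal{B}(\mathcal{M}^\perp)$ of the Toeplitz-type operator $W_{22}:\mathcal{N}^\perp\to\mathcal{M}^\perp$ is unitarily equivalent to the analytic Toeplitz operator $M_\Theta$ on $H^2_{\mathcal{E}}(\mathbb{D})$, where $\Theta\in H^\infty_{\mathcal{B}(\mathcal{E})}(\mathbb{D})$ is uniquely determined by $L$: $$\Theta(z)=\sum_{r\ge0}z^rL_r,\qquad L_r=(\langle e_1^r,\cdot\rangle\otimes I_{\mathcal{E}})L.$$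
   Context: Hilbert spaces are separable and complex; $\mathcal{B}(\mathcal{H},\mathcal{K})$ denotes bounded linear operators; $P_{\mathcal{S}}$ is the orthogonal projection onto a closed subspace $\mathcal{S}$. $F_n^+$ is the free monoid of words $\mu=\mu_1\cdots\mu_m$ in the letters $1,\dots,n$, with empty word $\emptyset$ and length $|\mu|$. The full Fock space $\mathcal{F}_n^2=\mathbb{C}\Omega\oplus\bigoplus_{k\ge1}(\mathbb{C}^n)^{\otimes k}$ has orthonormal basis $e_\mu=e_{\mu_1}\otimes\cdots\otimes e_{\mu_m}$, $\mu\in F_n^+$, with $e_\emptyset=\Omega$; $e_k^m:=e_k^{\otimes m}$, $e_k^0=\Omega$, and $\Omega$ acts as a unit for left tensoring. For $f\in\mathcal{F}_n^2\otimes\mathcal{E}$, $e_1^p\otimes f$ means left tensoring by $e_1^p$. Odometer map: for $L\in\mathcal{B}(\mathcal{E},\mathcal{F}_n^2\otimes\mathcal{E})$, $W_L$ is the operator on $\mathcal{F}_n^2\otimes\mathcal{E}$ given by $W_L(\Omega\otimes\eta)=L\eta$; $W_L(e_n^m\otimes\eta)=e_1^m\otimes L\eta$ for $m\ge1$; and, for a nonempty word $\mu=\mu_1\cdots\mu_m$ having some letter $\ne n$, with $k$ the smallest index such that $\mu_k\neq n$, $W_L(e_\mu\otimes\eta)=e_1^{k-1}\otimes e_{\mu_k+1}\otimes e_{\mu_{k+1}}\otimes\cdots\otimes e_{\mu_m}\otimes\eta$. It is a standing assumption that $W_L$ is a bounded operator on $\mathcal{F}_n^2\otimes\mathcal{E}$.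 $\mathcal{M}$ (resp. $\mathcal{N}$) is the closed span of all $e_\mu\otimes\xi$, $\xi\in\mathcal{E}$, with $|\mu|\ge1$ and some letter $\mu_i\ne1$ (resp. some letter $\mu_i\neq n$). So $\mathcal{M}^\perp=\overline{\mathrm{span}}\{e_1^m\otimes\xi:m\ge0,\xi\in\mathcal{E}\}$ and $\mathcal{N}^\perp=\overline{\mathrm{span}}\{e_n^m\otimes\xi:m\ge0,\xi\in\mathcal{E}\}$. $V:\mathcal{M}^\perp\to\mathcal{N}^\perp$ is the unitary $V(e_1^p\otimes\eta)=e_n^p\otimes\eta$. The operator $\langle e_1^r,\cdot\rangle\otimes I_{\mathcal{E}}:\mathcal{F}_n^2\otimes\mathcal{E}\to\mathcal{E}$ sends $e_\mu\otimes\eta$ to $\eta$ if $e_\mu=e_1^r$ and to $0$ otherwise. $H^2_{\mathcal{E}}(\mathbb{D})$ is the $\mathcal{E}$-valued Hardy space on the unit disc, $H^\infty_{\mathcal{B}(\mathcal{E})}(\mathbb{D})$ the bounded analytic $\mathcal{B}(\mathcal{E})$-valued functions, and $M_\Theta f(z)=\Theta(z)f(z)$. *)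

theory Defs
  imports "HOL-Analysis.Analysis"
begin

section \<open>Complex normed spaces and Hilbert spaces\<close>

class complex_vector = real_vector +
  fixes scaleC :: "complex \<Rightarrow> 'a \<Rightarrow> 'a" (infixr "*\<^sub>C" 75)
  assumes scaleC_add_right: "a *\<^sub>C (x + y) = a *\<^sub>C x + a *\<^sub>C y"
    and scaleC_add_left: "(a + b) *\<^sub>C x = a *\<^sub>C x + b *\<^sub>C x"
    and scaleC_scaleC: "a *\<^sub>C (b *\<^sub>C x) = (a * b) *\<^sub>C x"
    and scaleR_scaleC: "scaleR r x = complex_of_real r *\<^sub>C x"

lemma scaleC_one [simp]: "1 *\<^sub>C x = (x :: 'a :: complex_vector)"
  using scaleR_scaleC [of 1 x] by simp

global_interpretation complex_vector:
  vector_space "scaleC :: complex \<Rightarrow> 'a \<Rightarrow> 'a :: complex_vector"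
  by unfold_locales (simp_all add: scaleC_add_right scaleC_add_left scaleC_scaleC)

class complex_normed_vector = complex_vector + real_normed_vector +
  assumes norm_scaleC [simp]: "norm (a *\<^sub>C x) = cmod a * norm x"

text \<open>The inner product is conjugate-linear in the first and linear in the second argument.\<close>

class complex_inner = complex_normed_vector +
  fixes cinner :: "'a \<Rightarrow> 'a \<Rightarrow> complex"
  assumes cinner_commute: "cinner x y = cnj (cinner y x)"
    and cinner_add_right: "cinner x (y + z) = cinner x y + cinner x z"
    and cinner_scaleC_right: "cinner x (a *\<^sub>C y) = a * cinner x y"
    and cinner_self: "cinner x x = complex_of_real ((norm x)\<^sup>2)"

class chilbert_space = complex_inner + complete_space

instance chilbert_space \<subseteq> banach ..

lemma cinner_add_left: "cinner (x + y) z = cinner x z + cinner y (z :: 'a :: complex_inner)"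
  by (metis cinner_add_right cinner_commute complex_cnj_add)

lemma cinner_scaleC_left: "cinner (a *\<^sub>C x) y = cnj a * cinner x (y :: 'a :: complex_inner)"
  by (metis cinner_scaleC_right cinner_commute complex_cnj_mult)

lemma cinner_zero_right [simp]: "cinner x (0 :: 'a :: complex_inner) = 0"
  using cinner_scaleC_right [of x 0 x] by simp

lemma cinner_zero_left [simp]: "cinner (0 :: 'a :: complex_inner) x = 0"
  using cinner_scaleC_left [of 0 x x] by simp

lemma cinner_diff_right: "cinner x (y - z) = cinner x y - cinner x (z :: 'a :: complex_inner)"
  by (metis cinner_add_right diff_add_cancel eq_diff_eq)

lemma cinner_diff_left: "cinner (x - y) z = cinner x z - cinner y (z :: 'a :: complex_inner)"
  by (metis cinner_add_left diff_add_cancel eq_diff_eq)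

lemma cinner_self_eq_0 [simp]: "cinner x x = 0 \<longleftrightarrow> (x :: 'a :: complex_inner) = 0"
  by (simp add: cinner_self)

lemma cauchy_schwarz: "cmod (cinner x y) \<le> norm x * norm (y :: 'a :: complex_inner)"
proof (cases "y = 0")
  case False
  define c where "c = cinner y x"
  define w where "w = complex_of_real ((norm y)\<^sup>2) *\<^sub>C x - c *\<^sub>C y"
  have xy: "cinner x y = cnj c" unfolding c_def by (rule cinner_commute)
  have "cinner w w = complex_of_real ((norm y)\<^sup>2)
      * (complex_of_real ((norm y)\<^sup>2) * complex_of_real ((norm x)\<^sup>2) - c * cnj c)"
    unfolding w_def
    by (simp add: cinner_diff_left cinner_diff_right cinner_scaleC_left cinner_scaleC_right
        xy c_def[symmetric] cinner_self [of x] cinner_self [of y] algebra_simps)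
  also have "c * cnj c = complex_of_real ((cmod c)\<^sup>2)"
    by (simp add: complex_mult_cnj cmod_power2)
  finally have "complex_of_real ((norm w)\<^sup>2) = complex_of_real ((norm y)\<^sup>2
      * ((norm y)\<^sup>2 * (norm x)\<^sup>2 - (cmod c)\<^sup>2))"
    by (simp add: cinner_self)
  then have "(norm w)\<^sup>2 = (norm y)\<^sup>2 * ((norm y)\<^sup>2 * (norm x)\<^sup>2 - (cmod c)\<^sup>2)"
    by (simp only: of_real_eq_iff)
  then have "0 \<le> (norm y)\<^sup>2 * ((norm y)\<^sup>2 * (norm x)\<^sup>2 - (cmod c)\<^sup>2)"
    by (metis zero_le_power2)
  then have "(cmod c)\<^sup>2 \<le> (norm x * norm y)\<^sup>2"
    using False by (simp add: zero_le_mult_iff power_mult_distrib mult.commute)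
  then have "cmod c \<le> norm x * norm y"
    by (rule power2_le_imp_le) simp
  then show ?thesis by (simp add: xy)
qed simp

text \<open>Real-linear bounded maps into a complex space form a complex normed space; the bounded
  complex-linear maps are the elements satisfying \<open>clinear_blinfun\<close>.\<close>

lemma bounded_linear_scaleC: "bounded_linear ((*\<^sub>C) c :: 'a :: complex_normed_vector \<Rightarrow> 'a)"
  by (rule bounded_linear_intro [where K = "cmod c"])
    (simp_all add: scaleC_add_right scaleR_scaleC scaleC_scaleC mult.commute)

instantiation blinfun :: (real_normed_vector, complex_normed_vector) complex_normed_vector
begin

lift_definition scaleC_blinfun :: "complex \<Rightarrow> 'a \<Rightarrow>\<^sub>L 'b \<Rightarrow> 'a \<Rightarrow>\<^sub>L 'b" is "\<lambda>c f x. c *\<^sub>C f x"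
  by (rule bounded_linear_compose [OF bounded_linear_scaleC])

instance
proof
  fix a b :: complex and r :: real and x y :: "'a \<Rightarrow>\<^sub>L 'b"
  show "a *\<^sub>C (x + y) = a *\<^sub>C x + a *\<^sub>C y" by transfer (simp add: scaleC_add_right)
  show "(a + b) *\<^sub>C x = a *\<^sub>C x + b *\<^sub>C x" by transfer (simp add: scaleC_add_left)
  show "a *\<^sub>C b *\<^sub>C x = (a * b) *\<^sub>C x" by transfer (simp add: scaleC_scaleC)
  show "r *\<^sub>R x = complex_of_real r *\<^sub>C x" by transfer (simp add: scaleR_scaleC)
  have le: "norm (c *\<^sub>C z) \<le> cmod c * norm z" for c and z :: "'a \<Rightarrow>\<^sub>L 'b"
  proof (rule norm_blinfun_bound)
    fix v show "norm (blinfun_apply (c *\<^sub>C z) v) \<le> cmod c * norm z * norm v"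
      by (simp add: scaleC_blinfun.rep_eq mult.assoc mult_left_mono norm_blinfun)
  qed simp
  show "norm (a *\<^sub>C x) = cmod a * norm x"
  proof (cases "a = 0")
    case True
    then have "norm (a *\<^sub>C x) \<le> 0" using le [of a x] by simp
    then show ?thesis using True by simp
  next
    case False
    have "inverse a *\<^sub>C a *\<^sub>C x = x"
      using False by transfer (simp add: scaleC_scaleC)
    then have "norm x \<le> norm (a *\<^sub>C x) / cmod a"
      using le [of "inverse a" "a *\<^sub>C x"] by (simp add: norm_inverse divide_inverse mult.commute)
    then have "cmod a * norm x \<le> norm (a *\<^sub>C x)"
      using False by (simp add: pos_le_divide_eq mult.commute)
    then show ?thesis using le [of a x] by simp
  qed
qed

end

definition clinear_blinfun ::
  "('a :: complex_normed_vector \<Rightarrow>\<^sub>L 'b :: complex_normed_vector) \<Rightarrow> bool" where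
  "clinear_blinfun T \<longleftrightarrow> (\<forall>c x. blinfun_apply T (c *\<^sub>C x) = c *\<^sub>C blinfun_apply T x)"


section \<open>Operators between subspaces\<close>

text \<open>An operator between closed subspaces is a function on the ambient type, of which only the
  restriction to the domain subspace is relevant.\<close>

definition bounded_clinear_on ::
  "'a :: complex_normed_vector set \<Rightarrow> 'b :: complex_normed_vector set \<Rightarrow> ('a \<Rightarrow> 'b) \<Rightarrow> bool" where
  "bounded_clinear_on S R T \<longleftrightarrow>
     (\<forall>x\<in>S. T x \<in> R) \<and>
     (\<forall>x\<in>S. \<forall>y\<in>S. T (x + y) = T x + T y) \<and>
     (\<forall>c. \<forall>x\<in>S. T (c *\<^sub>C x) = c *\<^sub>C T x) \<and>
     (\<exists>K. \<forall>x\<in>S. norm (T x) \<le> K * norm x)"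

definition unitary_on ::
  "'a :: complex_inner set \<Rightarrow> 'b :: complex_inner set \<Rightarrow> ('a \<Rightarrow> 'b) \<Rightarrow> bool" where
  "unitary_on S R U \<longleftrightarrow>
     bounded_clinear_on S R U \<and> U ` S = R \<and>
     (\<forall>x\<in>S. \<forall>y\<in>S. cinner (U x) (U y) = cinner x y)"

definition unitarily_equivalent ::
  "'a :: complex_inner set \<Rightarrow> ('a \<Rightarrow> 'a) \<Rightarrow> 'b :: complex_inner set \<Rightarrow> ('b \<Rightarrow> 'b) \<Rightarrow> bool" where
  "unitarily_equivalent S T R T' \<longleftrightarrow>
     (\<exists>U. unitary_on S R U \<and> (\<forall>x\<in>S. U (T x) = T' (U x)))"

definition infinite_rank_on ::
  "'a :: complex_vector set \<Rightarrow> ('a \<Rightarrow> 'b :: complex_vector) \<Rightarrow> bool" where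
  "infinite_rank_on S T \<longleftrightarrow> \<not> (\<exists>B. finite B \<and> T ` S \<subseteq> complex_vector.span B)"

definition orth_proj :: "'a :: complex_inner set \<Rightarrow> 'a \<Rightarrow> 'a" where
  "orth_proj S x = (THE y. y \<in> S \<and> (\<forall>w\<in>S. cinner w (x - y) = 0))"

definition ocomplement :: "'a :: complex_inner set \<Rightarrow> 'a set \<Rightarrow> 'a set" where
  "ocomplement H S = {x \<in> H. \<forall>w\<in>S. cinner w x = 0}"

definition orth_decomposition :: "'a :: complex_inner set \<Rightarrow> 'a set \<Rightarrow> 'a set \<Rightarrow> bool" where
  "orth_decomposition H A B \<longleftrightarrow>
     complex_vector.subspace A \<and> closed A \<and> complex_vector.subspace B \<and> closed B \<and>
     (\<forall>x\<in>A. \<forall>y\<in>B. cinner x y = 0) \<and>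
     H = {x + y | x y. x \<in> A \<and> y \<in> B}"

text \<open>The block matrix with rows \<open>T11 T12\<close> and \<open>T21 T22\<close> represents \<open>T\<close> with respect to
  \<open>A1 \<oplus> A2\<close> in the domain and \<open>B1 \<oplus> B2\<close> in the codomain.\<close>

definition block_decomposition ::
  "'a :: complex_inner set \<Rightarrow> 'a set \<Rightarrow> 'b :: complex_inner set \<Rightarrow> 'b set \<Rightarrow> ('a \<Rightarrow> 'b) \<Rightarrow>
   ('a \<Rightarrow> 'b) \<Rightarrow> ('a \<Rightarrow> 'b) \<Rightarrow> ('a \<Rightarrow> 'b) \<Rightarrow> ('a \<Rightarrow> 'b) \<Rightarrow> bool" where
  "block_decomposition A1 A2 B1 B2 T T11 T12 T21 T22 \<longleftrightarrow>
     bounded_clinear_on A1 B1 T11 \<and> bounded_clinear_on A2 B1 T12 \<and>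
     bounded_clinear_on A1 B2 T21 \<and> bounded_clinear_on A2 B2 T22 \<and>
     (\<forall>x\<in>A1. \<forall>y\<in>A2. T (x + y) = (T11 x + T12 y) + (T21 x + T22 y))"


section \<open>Square-summable families\<close>

typedef (overloaded) ('i, 'e) l2 =
  "{f :: 'i \<Rightarrow> 'e :: complex_inner. (\<lambda>i. (norm (f i))\<^sup>2) summable_on UNIV}"
  morphisms coord Abs_l2
  by (rule exI [of _ "\<lambda>_. 0"]) simp

setup_lifting type_definition_l2

lemma l2_memI:
  fixes f :: "'i \<Rightarrow> 'e :: complex_inner"
  assumes "\<And>F. finite F \<Longrightarrow> L2_set (\<lambda>i. norm (f i)) F \<le> K"
  shows "(\<lambda>i. (norm (f i))\<^sup>2) summable_on UNIV"
    and "sqrt (\<Sum>\<^sub>\<infinity>i. (norm (f i))\<^sup>2) \<le> K"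
proof -
  have K: "0 \<le> K" using assms [of "{}"] by simp
  have b: "(\<Sum>i\<in>F. (norm (f i))\<^sup>2) \<le> K\<^sup>2" if "finite F" for F
  proof -
    have "(L2_set (\<lambda>i. norm (f i)) F)\<^sup>2 \<le> K\<^sup>2"
      using assms [OF that] by (intro power_mono) auto
    then show ?thesis by (simp add: L2_set_def sum_nonneg)
  qed
  show s: "(\<lambda>i. (norm (f i))\<^sup>2) summable_on UNIV"
    by (rule nonneg_bdd_above_summable_on) (auto simp: bdd_above_def intro!: b)
  have "(\<Sum>\<^sub>\<infinity>i. (norm (f i))\<^sup>2) \<le> K\<^sup>2"
    by (rule infsum_le_finite_sums [OF s]) (simp add: b)
  then show "sqrt (\<Sum>\<^sub>\<infinity>i. (norm (f i))\<^sup>2) \<le> K"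
    using K real_le_lsqrt by (simp add: real_le_lsqrt)
qed

lemma l2_L2_set_le:
  fixes f :: "'i \<Rightarrow> 'e :: complex_inner"
  assumes "(\<lambda>i. (norm (f i))\<^sup>2) summable_on UNIV" "finite F"
  shows "L2_set (\<lambda>i. norm (f i)) F \<le> sqrt (\<Sum>\<^sub>\<infinity>i. (norm (f i))\<^sup>2)"
  unfolding L2_set_def
  by (intro real_sqrt_le_mono finite_sum_le_infsum) (use assms in auto)

lemma l2_add_aux:
  fixes f g :: "'i \<Rightarrow> 'e :: complex_inner"
  assumes "(\<lambda>i. (norm (f i))\<^sup>2) summable_on UNIV" "(\<lambda>i. (norm (g i))\<^sup>2) summable_on UNIV"
  shows "(\<lambda>i. (norm (f i + g i))\<^sup>2) summable_on UNIV"
    and "sqrt (\<Sum>\<^sub>\<infinity>i. (norm (f i + g i))\<^sup>2)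
      \<le> sqrt (\<Sum>\<^sub>\<infinity>i. (norm (f i))\<^sup>2) + sqrt (\<Sum>\<^sub>\<infinity>i. (norm (g i))\<^sup>2)"
proof -
  have *: "L2_set (\<lambda>i. norm (f i + g i)) F
      \<le> sqrt (\<Sum>\<^sub>\<infinity>i. (norm (f i))\<^sup>2) + sqrt (\<Sum>\<^sub>\<infinity>i. (norm (g i))\<^sup>2)" if "finite F" for F
  proof -
    have "L2_set (\<lambda>i. norm (f i + g i)) F \<le> L2_set (\<lambda>i. norm (f i) + norm (g i)) F"
      by (intro L2_set_mono) (auto intro: norm_triangle_ineq)
    also have "\<dots> \<le> L2_set (\<lambda>i. norm (f i)) F + L2_set (\<lambda>i. norm (g i)) F"
      by (rule L2_set_triangle_ineq)
    finally show ?thesis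
      using l2_L2_set_le [OF assms(1) that] l2_L2_set_le [OF assms(2) that] by linarith
  qed
  show "(\<lambda>i. (norm (f i + g i))\<^sup>2) summable_on UNIV" using l2_memI(1) [OF *] .
  show "sqrt (\<Sum>\<^sub>\<infinity>i. (norm (f i + g i))\<^sup>2)
      \<le> sqrt (\<Sum>\<^sub>\<infinity>i. (norm (f i))\<^sup>2) + sqrt (\<Sum>\<^sub>\<infinity>i. (norm (g i))\<^sup>2)"
    using l2_memI(2) [OF *] .
qed

lemma l2_cmul_aux:
  fixes f :: "'i \<Rightarrow> 'e :: complex_inner"
  assumes "(\<lambda>i. (norm (f i))\<^sup>2) summable_on UNIV"
  shows "(\<lambda>i. (norm (c *\<^sub>C f i))\<^sup>2) summable_on UNIV"
  using summable_on_cmult_right [OF assms, of "(cmod c)\<^sup>2"] by (simp add: power_mult_distrib)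

lemma l2_cinner_summable:
  fixes f g :: "'i \<Rightarrow> 'e :: complex_inner"
  assumes "(\<lambda>i. (norm (f i))\<^sup>2) summable_on UNIV" "(\<lambda>i. (norm (g i))\<^sup>2) summable_on UNIV"
  shows "(\<lambda>i. cinner (f i) (g i)) summable_on UNIV"
proof -
  have "(\<lambda>i. norm (cinner (f i) (g i))) summable_on UNIV"
  proof (rule summable_on_comparison_test)
    show "(\<lambda>i. (norm (f i))\<^sup>2 + (norm (g i))\<^sup>2) summable_on UNIV"
      by (rule summable_on_add [OF assms])
    fix i
    have "cmod (cinner (f i) (g i)) \<le> norm (f i) * norm (g i)" by (rule cauchy_schwarz)
    also have "\<dots> \<le> (norm (f i))\<^sup>2 + (norm (g i))\<^sup>2"
      using sum_squares_bound [of "norm (f i)" "norm (g i)"]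
        mult_nonneg_nonneg [OF norm_ge_zero norm_ge_zero, of "f i" "g i"] by linarith
    finally show "cmod (cinner (f i) (g i)) \<le> (norm (f i))\<^sup>2 + (norm (g i))\<^sup>2" .
  qed auto
  then show ?thesis by (rule abs_summable_summable)
qed

instantiation l2 :: (type, complex_inner) complex_inner
begin

lift_definition zero_l2 :: "('a, 'b) l2" is "\<lambda>_. 0" by simp
lift_definition plus_l2 :: "('a, 'b) l2 \<Rightarrow> ('a, 'b) l2 \<Rightarrow> ('a, 'b) l2" is "\<lambda>f g i. f i + g i"
  by (rule l2_add_aux)
lift_definition scaleC_l2 :: "complex \<Rightarrow> ('a, 'b) l2 \<Rightarrow> ('a, 'b) l2" is "\<lambda>c f i. c *\<^sub>C f i"
  by (rule l2_cmul_aux)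
lift_definition uminus_l2 :: "('a, 'b) l2 \<Rightarrow> ('a, 'b) l2" is "\<lambda>f i. - f i" by simp
lift_definition minus_l2 :: "('a, 'b) l2 \<Rightarrow> ('a, 'b) l2 \<Rightarrow> ('a, 'b) l2" is "\<lambda>f g i. f i - g i"
  subgoal for f g using l2_add_aux(1) [of f "\<lambda>i. - g i"] by simp
  done
lift_definition scaleR_l2 :: "real \<Rightarrow> ('a, 'b) l2 \<Rightarrow> ('a, 'b) l2" is "\<lambda>c f i. c *\<^sub>R f i"
  unfolding scaleR_scaleC by (rule l2_cmul_aux)
lift_definition cinner_l2 :: "('a, 'b) l2 \<Rightarrow> ('a, 'b) l2 \<Rightarrow> complex"
  is "\<lambda>f g. \<Sum>\<^sub>\<infinity>i. cinner (f i) (g i)" .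
lift_definition norm_l2 :: "('a, 'b) l2 \<Rightarrow> real" is "\<lambda>f. sqrt (\<Sum>\<^sub>\<infinity>i. (norm (f i))\<^sup>2)" .
definition "dist_l2 (f :: ('a, 'b) l2) g = norm (f - g)"
definition "sgn_l2 (f :: ('a, 'b) l2) = inverse (norm f) *\<^sub>R f"
definition "(uniformity :: (('a, 'b) l2 \<times> ('a, 'b) l2) filter) =
  (INF e\<in>{0<..}. principal {(x, y). dist x y < e})"
definition "open_l2 (S :: ('a, 'b) l2 set) \<longleftrightarrow>
  (\<forall>x\<in>S. \<forall>\<^sub>F (x', y) in uniformity. x' = x \<longrightarrow> y \<in> S)"

instance
proof
  fix f g h :: "('a, 'b) l2" and a b :: complex and r s :: real
  show "f + g + h = f + (g + h)" by transfer (simp add: add.assoc)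
  show "f + g = g + f" by transfer (simp add: add.commute)
  show "0 + f = f" by transfer simp
  show "- f + f = 0" by transfer simp
  show "f - g = f + - g" by transfer simp
  show "r *\<^sub>R (f + g) = r *\<^sub>R f + r *\<^sub>R g" by transfer (simp add: scaleR_add_right)
  show "(r + s) *\<^sub>R f = r *\<^sub>R f + s *\<^sub>R f" by transfer (simp add: scaleR_add_left)
  show "r *\<^sub>R s *\<^sub>R f = (r * s) *\<^sub>R f" by transfer simp
  show "1 *\<^sub>R f = f" by transfer simp
  show "a *\<^sub>C (f + g) = a *\<^sub>C f + a *\<^sub>C g" by transfer (simp add: scaleC_add_right)
  show "(a + b) *\<^sub>C f = a *\<^sub>C f + b *\<^sub>C f" by transfer (simp add: scaleC_add_left)
  show "a *\<^sub>C b *\<^sub>C f = (a * b) *\<^sub>C f" by transfer (simp add: scaleC_scaleC)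
  show "r *\<^sub>R f = complex_of_real r *\<^sub>C f" by transfer (simp add: scaleR_scaleC)
  show "dist f g = norm (f - g)" by (rule dist_l2_def)
  show "sgn f = inverse (norm f) *\<^sub>R f" by (rule sgn_l2_def)
  show "(uniformity :: (('a, 'b) l2 \<times> ('a, 'b) l2) filter) =
    (INF e\<in>{0<..}. principal {(x, y). dist x y < e})" by (rule uniformity_l2_def)
  show "open S \<longleftrightarrow> (\<forall>x\<in>S. \<forall>\<^sub>F (x', y) in uniformity. x' = x \<longrightarrow> y \<in> S)" for S :: "('a, 'b) l2 set"
    by (rule open_l2_def)
  show "norm f = 0 \<longleftrightarrow> f = 0"
  proof transfer
    fix f :: "'a \<Rightarrow> 'b" assume f: "(\<lambda>i. (norm (f i))\<^sup>2) summable_on UNIV"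
    show "sqrt (\<Sum>\<^sub>\<infinity>i. (norm (f i))\<^sup>2) = 0 \<longleftrightarrow> f = (\<lambda>_. 0)"
    proof
      assume "sqrt (\<Sum>\<^sub>\<infinity>i. (norm (f i))\<^sup>2) = 0"
      then have "(norm (f i))\<^sup>2 = 0" for i
        using nonneg_infsum_le_0D [OF _ f, of i] by simp
      then show "f = (\<lambda>_. 0)" by auto
    qed simp
  qed
  show "norm (f + g) \<le> norm f + norm g" by transfer (rule l2_add_aux)
  have nC: "norm (c *\<^sub>C f) = cmod c * norm f" for c
    by transfer (simp add: power_mult_distrib infsum_cmult_right' real_sqrt_mult)
  show "norm (a *\<^sub>C f) = cmod a * norm f" by (rule nC)
  have "r *\<^sub>R f = complex_of_real r *\<^sub>C f" by transfer (simp add: scaleR_scaleC)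
  then show "norm (r *\<^sub>R f) = \<bar>r\<bar> * norm f" by (simp add: nC)
  show "cinner f g = cnj (cinner g f)"
    by transfer (simp flip: infsum_cnj cinner_commute)
  show "cinner f (g + h) = cinner f g + cinner f h"
    by transfer (simp add: cinner_add_right infsum_add l2_cinner_summable)
  show "cinner f (a *\<^sub>C g) = a * cinner f g"
    by transfer (simp add: cinner_scaleC_right infsum_cmult_right')
  show "cinner f f = complex_of_real ((norm f)\<^sup>2)"
  proof transfer
    fix f :: "'a \<Rightarrow> 'b" assume f: "(\<lambda>i. (norm (f i))\<^sup>2) summable_on UNIV"
    have "((\<lambda>i. complex_of_real ((norm (f i))\<^sup>2)) has_sum
      complex_of_real (\<Sum>\<^sub>\<infinity>i. (norm (f i))\<^sup>2)) UNIV"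
      by (rule has_sum_of_real) (rule has_sum_infsum [OF f])
    then show "(\<Sum>\<^sub>\<infinity>i. cinner (f i) (f i)) = complex_of_real ((sqrt (\<Sum>\<^sub>\<infinity>i. (norm (f i))\<^sup>2))\<^sup>2)"
      by (simp add: cinner_self infsumI infsum_nonneg)
  qed
qed

end

lemma norm_coord_le: "norm (coord (f :: ('i, 'e :: complex_inner) l2) i) \<le> norm f"
proof transfer
  fix f :: "'i \<Rightarrow> 'e" and i assume "(\<lambda>i. (norm (f i))\<^sup>2) summable_on UNIV"
  from l2_L2_set_le [OF this, of "{i}"]
  show "norm (f i) \<le> sqrt (\<Sum>\<^sub>\<infinity>i. (norm (f i))\<^sup>2)" by simp
qed

lemma bounded_linear_coord: "bounded_linear (\<lambda>f :: ('i, 'e :: complex_inner) l2. coord f i)"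
proof (rule bounded_linear_intro [where K = 1])
  fix f g :: "('i, 'e) l2" and r :: real
  show "coord (f + g) i = coord f i + coord g i" by (simp only: plus_l2.rep_eq)
  show "coord (r *\<^sub>R f) i = r *\<^sub>R coord f i" by (simp only: scaleR_l2.rep_eq)
  show "norm (coord f i) \<le> norm f * 1" using norm_coord_le [of f i] by simp
qed

instance l2 :: (type, chilbert_space) chilbert_space
proof
  fix X :: "nat \<Rightarrow> ('a, 'b) l2"
  assume X: "Cauchy X"
  have "\<exists>l. (\<lambda>k. coord (X k) i) \<longlonglongrightarrow> l" for i
    using bounded_linear.Cauchy [OF bounded_linear_coord X, of i] Cauchy_convergent convergent_def
    by blast
  then obtain g where g: "\<And>i. (\<lambda>k. coord (X k) i) \<longlonglongrightarrow> g i" by metis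
  have fin: "L2_set (\<lambda>i. norm (coord (X m) i - g i)) F \<le> e"
    if e: "\<forall>k\<ge>N. norm (X m - X k) \<le> e" and F: "finite F" for m N e F
  proof (rule LIMSEQ_le_const2)
    show "(\<lambda>k. L2_set (\<lambda>i. norm (coord (X m) i - coord (X k) i)) F)
      \<longlonglongrightarrow> L2_set (\<lambda>i. norm (coord (X m) i - g i)) F"
      unfolding L2_set_def by (intro tendsto_intros g)
    show "\<exists>N. \<forall>k\<ge>N. L2_set (\<lambda>i. norm (coord (X m) i - coord (X k) i)) F \<le> e"
    proof (intro exI allI impI)
      fix k assume "k \<ge> N"
      have "L2_set (\<lambda>i. norm (coord (X m - X k) i)) F \<le> norm (X m - X k)"
        unfolding norm_l2.rep_eq using coord F by (intro l2_L2_set_le) auto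
      then show "L2_set (\<lambda>i. norm (coord (X m) i - coord (X k) i)) F \<le> e"
        using e \<open>k \<ge> N\<close> by (auto simp: minus_l2.rep_eq intro: order_trans)
    qed
  qed
  have ev: "\<exists>N. \<forall>m\<ge>N. \<forall>k\<ge>N. norm (X m - X k) \<le> e" if "e > 0" for e
    using CauchyD [OF X that] by (meson less_imp_le)
  obtain N1 where N1: "\<forall>m\<ge>N1. \<forall>k\<ge>N1. norm (X m - X k) \<le> 1" using ev [of 1] by auto
  have "(\<lambda>i. (norm (coord (X N1) i - g i))\<^sup>2) summable_on UNIV"
    by (rule l2_memI(1) [OF fin]) (use N1 in auto)
  from l2_add_aux(1) [OF _ this, of "\<lambda>i. - coord (X N1) i"] coord [of "X N1"]
  have "(\<lambda>i. (norm (g i))\<^sup>2) summable_on UNIV" by simp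
  then have G: "coord (Abs_l2 g) = g" by (simp add: Abs_l2_inverse)
  have "X \<longlonglongrightarrow> Abs_l2 g"
  proof (rule LIMSEQ_I)
    fix e :: real assume "e > 0"
    then obtain N where N: "\<forall>m\<ge>N. \<forall>k\<ge>N. norm (X m - X k) \<le> e / 2" using ev [of "e/2"] by auto
    have "norm (X m - Abs_l2 g) < e" if "m \<ge> N" for m
    proof -
      have "norm (X m - Abs_l2 g) \<le> e / 2"
        unfolding norm_l2.rep_eq minus_l2.rep_eq G
        by (rule l2_memI(2) [OF fin]) (use N that in auto)
      then show ?thesis using \<open>e > 0\<close> by simp
    qed
    then show "\<exists>N. \<forall>m\<ge>N. norm (X m - Abs_l2 g) < e" by blast
  qed
  then show "convergent X" by (auto simp: convergent_def)
qed


section \<open>The Fock space and the odometer map\<close>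

definition words :: "nat \<Rightarrow> nat list set" where
  "words n = lists {1..n}"

text \<open>The Hilbert space tensor product of the full Fock space with \<open>\<E>\<close> is realised as the space of
  square-summable \<open>\<E>\<close>-valued families indexed by the words; \<open>ebasis \<mu> \<eta>\<close> is the elementary
  tensor \<open>e\<^sub>\<mu> \<otimes> \<eta>\<close>, and the empty word gives the vacuum vector. In order to keep \<open>n\<close> a number,
  the ambient type has all lists of numbers as indices. The lemmas \<open>cinner_ebasis\<close> and
  \<open>fock_eq_closure_span\<close> below characterise the tensor product.\<close>

definition fock :: "nat \<Rightarrow> (nat list, 'e :: complex_inner) l2 set" where
  "fock n = {f. \<forall>\<mu>. \<mu> \<notin> words n \<longrightarrow> coord f \<mu> = 0}"

lemma summable_single:
  "(\<lambda>j. (norm (if j = i then x else (0 :: 'e :: real_normed_vector)))\<^sup>2) summable_on UNIV"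
  by (rule finite_nonzero_values_imp_summable_on) (rule finite_subset [of _ "{i}"], auto)

lift_definition ebasis :: "'i \<Rightarrow> 'e :: complex_inner \<Rightarrow> ('i, 'e) l2"
  is "\<lambda>i x j. if j = i then x else 0"
  by (rule summable_single)

lemma summable_left_tensor:
  fixes f :: "'a list \<Rightarrow> 'e :: complex_inner"
  assumes "(\<lambda>i. (norm (f i))\<^sup>2) summable_on UNIV"
  shows "(\<lambda>\<mu>. (norm (if take (length \<nu>) \<mu> = \<nu> then f (drop (length \<nu>) \<mu>) else 0))\<^sup>2) summable_on UNIV"
proof -
  have "(\<lambda>\<mu>. (norm (f (drop (length \<nu>) \<mu>)))\<^sup>2) summable_on range ((@) \<nu>)"
    by (subst summable_on_reindex) (auto simp: inj_on_def o_def assms)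
  moreover have "\<mu> \<in> range ((@) \<nu>)" if "take (length \<nu>) \<mu> = \<nu>" for \<mu>
    by (rule range_eqI [of _ _ "drop (length \<nu>) \<mu>"]) (metis append_take_drop_id that)
  ultimately show ?thesis
    by (subst summable_on_cong_neutral [where T = "range ((@) \<nu>)"
          and g = "\<lambda>\<mu>. (norm (f (drop (length \<nu>) \<mu>)))\<^sup>2"]) auto
qed

lemma cinner_ebasis:
  "cinner (ebasis \<mu> \<eta>) (ebasis \<nu> \<xi>) = (if \<mu> = \<nu> then cinner \<eta> \<xi> else 0)"
proof transfer
  fix \<mu> \<nu> :: 'a and \<eta> \<xi> :: 'b
  have "(\<Sum>\<^sub>\<infinity>j. cinner (if j = \<mu> then \<eta> else 0) (if j = \<nu> then \<xi> else 0)) =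
      (\<Sum>\<^sub>\<infinity>j\<in>{\<mu>}. cinner (if j = \<mu> then \<eta> else 0) (if j = \<nu> then \<xi> else 0))"
    by (rule infsum_cong_neutral) auto
  then show "(\<Sum>\<^sub>\<infinity>j. cinner (if j = \<mu> then \<eta> else 0) (if j = \<nu> then \<xi> else 0)) =
      (if \<mu> = \<nu> then cinner \<eta> \<xi> else 0)"
    by simp
qed

lemma coord_sum: "coord (sum f A) i = (\<Sum>a\<in>A. coord (f a :: ('i, 'e :: complex_inner) l2) i)"
  by (induction A rule: infinite_finite_induct) (simp_all add: zero_l2.rep_eq plus_l2.rep_eq)

lemma ebasis_approx:
  fixes f :: "('i, 'e :: complex_inner) l2"
  assumes "e > 0"
  obtains F where "finite F" and "norm (f - (\<Sum>i\<in>F. ebasis i (coord f i))) < e"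
proof -
  define q where "q i = (norm (coord f i))\<^sup>2" for i
  have q: "q summable_on UNIV" unfolding q_def using coord [of f] by simp
  obtain F where F: "finite F" and d: "dist (sum q F) (infsum q UNIV) \<le> e\<^sup>2 / 2"
    using infsum_finite_approximation [OF q, of "e\<^sup>2 / 2"] assms by auto
  have co: "coord (f - (\<Sum>i\<in>F. ebasis i (coord f i))) j = (if j \<in> F then 0 else coord f j)" for j
    using F by (simp add: minus_l2.rep_eq coord_sum ebasis.rep_eq sum.delta')
  have "(norm (f - (\<Sum>i\<in>F. ebasis i (coord f i))))\<^sup>2 = (\<Sum>\<^sub>\<infinity>j. (norm (if j \<in> F then 0 else coord f j))\<^sup>2)"
    by (simp add: norm_l2.rep_eq co infsum_nonneg)
  also have "\<dots> = infsum q (- F)"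
    by (rule infsum_cong_neutral) (auto simp: q_def)
  also have "\<dots> = infsum q UNIV - sum q F"
    using infsum_Un_disjoint [of q F "- F"] F q
    by (simp add: summable_on_subset_banach [OF q] Compl_partition)
  also have "\<dots> < e\<^sup>2"
  proof -
    have "0 < e\<^sup>2" using assms by simp
    moreover have "\<bar>sum q F - infsum q UNIV\<bar> \<le> e\<^sup>2 / 2" using d unfolding dist_real_def .
    ultimately show ?thesis by linarith
  qed
  finally have "norm (f - (\<Sum>i\<in>F. ebasis i (coord f i))) < e"
    using assms power_less_imp_less_base by fastforce
  with F show thesis by (rule that)
qed

lemma closed_fock: "closed (fock n :: (nat list, 'e :: complex_inner) l2 set)"
proof -
  have "closed {f :: (nat list, 'e) l2. \<mu> \<notin> words n \<longrightarrow> coord f \<mu> = 0}" for \<mu>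
    by (cases "\<mu> \<in> words n")
      (auto intro!: closed_Collect_eq linear_continuous_on bounded_linear_coord continuous_on_const)
  then show ?thesis unfolding fock_def Collect_all_eq by (intro closed_INT) auto
qed

lemma subspace_fock: "complex_vector.subspace (fock n :: (nat list, 'e :: complex_inner) l2 set)"
  unfolding complex_vector.subspace_def fock_def
  by (auto simp: zero_l2.rep_eq plus_l2.rep_eq scaleC_l2.rep_eq)

lemma fock_eq_closure_span:
  "fock n = closure (complex_vector.span
     {ebasis \<mu> \<xi> | \<mu> (\<xi> :: 'e :: complex_inner). \<mu> \<in> words n})"
proof
  let ?S = "{ebasis \<mu> \<xi> | \<mu> (\<xi> :: 'e). \<mu> \<in> words n}"
  have "?S \<subseteq> fock n" by (auto simp: fock_def ebasis.rep_eq)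
  then show "closure (complex_vector.span ?S) \<subseteq> fock n"
    by (intro closure_minimal complex_vector.span_minimal subspace_fock closed_fock)
  show "fock n \<subseteq> closure (complex_vector.span ?S)"
  proof
    fix f :: "(nat list, 'e) l2" assume f: "f \<in> fock n"
    have z: "ebasis i (0 :: 'e) = 0" for i :: "nat list" by transfer auto
    show "f \<in> closure (complex_vector.span ?S)"
      unfolding closure_approachable
    proof (intro allI impI)
      fix e :: real assume "e > 0"
      then obtain F where F: "finite F" "norm (f - (\<Sum>i\<in>F. ebasis i (coord f i))) < e"
        by (rule ebasis_approx)
      have "ebasis i (coord f i) \<in> complex_vector.span ?S" for i
      proof (cases "i \<in> words n")
        case True
        then show ?thesis by (intro complex_vector.span_base) auto
      next
        case False
        then show ?thesis using f by (simp add: fock_def z complex_vector.span_zero)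
      qed
      then have "(\<Sum>i\<in>F. ebasis i (coord f i)) \<in> complex_vector.span ?S"
        by (intro complex_vector.span_sum)
      then show "\<exists>y\<in>complex_vector.span ?S. dist y f < e"
        using F(2) by (auto simp: dist_norm norm_minus_commute)
    qed
  qed
qed

text \<open>Left tensoring by \<open>e\<^sub>\<nu>\<close>.\<close>

lift_definition left_tensor :: "'a list \<Rightarrow> ('a list, 'e :: complex_inner) l2 \<Rightarrow> ('a list, 'e) l2"
  is "\<lambda>\<nu> f \<mu>. if take (length \<nu>) \<mu> = \<nu> then f (drop (length \<nu>) \<mu>) else 0"
  by (rule summable_left_tensor)

lemma left_tensor_ebasis: "left_tensor \<nu> (ebasis \<mu> \<eta>) = ebasis (\<nu> @ \<mu>) \<eta>"
proof -
  have "(if take (length \<nu>) j = \<nu> then if drop (length \<nu>) j = \<mu> then \<eta> else 0 else 0) =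
      (if j = \<nu> @ \<mu> then \<eta> else 0)" for j
    using append_eq_conv_conj [of \<nu> \<mu> j] by auto
  then show ?thesis by transfer (simp add: fun_eq_iff)
qed

text \<open>List positions start at \<open>0\<close>, so \<open>k\<close> here is one less than the index of the first letter
  different from \<open>n\<close>.\<close>

definition odometer_word :: "nat \<Rightarrow> nat list \<Rightarrow> nat list" where
  "odometer_word n \<mu> =
     (let k = (LEAST i. i < length \<mu> \<and> \<mu> ! i \<noteq> n)
      in replicate k 1 @ (\<mu> ! k + 1) # drop (Suc k) \<mu>)"

text \<open>Boundedness of \<open>W\<close> is part of the notion: a bounded operator on \<open>fock n\<close> is determined by its
  values on elementary tensors.\<close>

definition is_odometer_map ::
  "nat \<Rightarrow> ('e :: complex_inner \<Rightarrow> (nat list, 'e) l2) \<Rightarrow>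
   ((nat list, 'e) l2 \<Rightarrow> (nat list, 'e) l2) \<Rightarrow> bool" where
  "is_odometer_map n L W \<longleftrightarrow>
     bounded_clinear_on (fock n) (fock n) W \<and>
     (\<forall>\<eta>. W (ebasis [] \<eta>) = L \<eta>) \<and>
     (\<forall>m\<ge>1. \<forall>\<eta>. W (ebasis (replicate m n) \<eta>) = left_tensor (replicate m 1) (L \<eta>)) \<and>
     (\<forall>\<mu>\<in>words n. (\<exists>i<length \<mu>. \<mu> ! i \<noteq> n) \<longrightarrow>
        (\<forall>\<eta>. W (ebasis \<mu> \<eta>) = ebasis (odometer_word n \<mu>) \<eta>))"

definition space_M :: "nat \<Rightarrow> (nat list, 'e :: complex_inner) l2 set" where
  "space_M n = closure (complex_vector.span
     {ebasis \<mu> \<xi> | \<mu> \<xi>. \<mu> \<in> words n \<and> length \<mu> \<ge> 1 \<and> (\<exists>i<length \<mu>. \<mu> ! i \<noteq> 1)})"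

definition space_N :: "nat \<Rightarrow> (nat list, 'e :: complex_inner) l2 set" where
  "space_N n = closure (complex_vector.span
     {ebasis \<mu> \<xi> | \<mu> \<xi>. \<mu> \<in> words n \<and> length \<mu> \<ge> 1 \<and> (\<exists>i<length \<mu>. \<mu> ! i \<noteq> n)})"

definition space_M_perp :: "nat \<Rightarrow> (nat list, 'e :: complex_inner) l2 set" where
  "space_M_perp n = ocomplement (fock n) (space_M n)"

definition space_N_perp :: "nat \<Rightarrow> (nat list, 'e :: complex_inner) l2 set" where
  "space_N_perp n = ocomplement (fock n) (space_N n)"

lemma summable_shuffle:
  fixes f :: "nat list \<Rightarrow> 'e :: complex_inner"
  assumes "(\<lambda>i. (norm (f i))\<^sup>2) summable_on UNIV"
  shows "(\<lambda>\<mu>. (norm (if \<mu> = replicate (length \<mu>) n then f (replicate (length \<mu>) 1) else 0))\<^sup>2)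
    summable_on UNIV"
proof -
  have "(\<lambda>\<mu>. (norm (f \<mu>))\<^sup>2) summable_on range (\<lambda>p. replicate p 1)"
    using assms by (rule summable_on_subset) simp
  then have "(\<lambda>p. (norm (f (replicate p 1)))\<^sup>2) summable_on UNIV"
    by (subst (asm) summable_on_reindex) (auto simp: inj_on_def o_def dest: replicate_eq_replicate [THEN iffD1])
  then have "(\<lambda>\<mu>. (norm (f (replicate (length \<mu>) 1)))\<^sup>2) summable_on range (\<lambda>p. replicate p n)"
    by (subst summable_on_reindex) (auto simp: inj_on_def o_def)
  then show ?thesis
    by (subst summable_on_cong_neutral [where T = "range (\<lambda>p. replicate p n)"
          and g = "\<lambda>\<mu>. (norm (f (replicate (length \<mu>) 1)))\<^sup>2"]) auto
qed

text \<open>The unitary \<open>V\<close> from \<open>space_M_perp n\<close> onto \<open>space_N_perp n\<close> (only its values on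
  \<open>space_M_perp n\<close> are relevant).\<close>

lift_definition shuffle_V ::
  "nat \<Rightarrow> (nat list, 'e :: complex_inner) l2 \<Rightarrow> (nat list, 'e) l2"
  is "\<lambda>n f \<mu>. if \<mu> = replicate (length \<mu>) n then f (replicate (length \<mu>) 1) else 0"
  by (rule summable_shuffle)

lemma shuffle_V_ebasis: "shuffle_V n (ebasis (replicate p 1) \<eta>) = ebasis (replicate p n) \<eta>"
proof -
  have "(if j = replicate (length j) n
        then if replicate (length j) 1 = replicate p (1 :: nat) then \<eta> else 0 else 0) =
      (if j = replicate p n then \<eta> else 0)" for j
    by (cases "length j = p") auto
  then show ?thesis by transfer (simp add: fun_eq_iff)
qed

text \<open>The operator \<open>\<langle>e\<^sub>1\<^sup>r, \<cdot>\<rangle> \<otimes> I\<close> reads off the coordinate at the word \<open>1\<dots>1\<close> of length \<open>r\<close>.\<close>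

definition symbol_coeff ::
  "('e :: complex_inner \<Rightarrow> (nat list, 'e) l2) \<Rightarrow> nat \<Rightarrow> 'e \<Rightarrow>\<^sub>L 'e" where
  "symbol_coeff L r = Blinfun (\<lambda>\<eta>. coord (L \<eta>) (replicate r 1))"


section \<open>The Hardy space and analytic Toeplitz operators\<close>

lemma powser_coeff_unique:
  fixes a b :: "nat \<Rightarrow> 'e :: chilbert_space"
  assumes a: "\<And>z. cmod z < 1 \<Longrightarrow> (\<lambda>k. z ^ k *\<^sub>C a k) sums f z"
    and b: "\<And>z. cmod z < 1 \<Longrightarrow> (\<lambda>k. z ^ k *\<^sub>C b k) sums f z"
  shows "a = b"
proof -
  have "cinner v (a k - b k) = 0" for v k
  proof (induction k rule: less_induct)
    case (less k)
    define c where "c k = cinner v (a k - b k)" for k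
    have bl: "bounded_linear (cinner v)"
    proof (rule bounded_linear_intro [where K = "norm v"])
      fix x y :: 'e and r :: real
      show "cinner v (x + y) = cinner v x + cinner v y" by (rule cinner_add_right)
      show "cinner v (r *\<^sub>R x) = r *\<^sub>R cinner v x"
        by (simp add: scaleR_scaleC [of r x] cinner_scaleC_right scaleR_conv_of_real)
      show "norm (cinner v x) \<le> norm x * norm v"
        using cauchy_schwarz [of v x] by (simp add: mult.commute)
    qed
    have c: "(\<lambda>k. c k * z ^ k) sums 0" if "cmod z < 1" for z
      using bounded_linear.sums [OF bl sums_diff [OF a [OF that] b [OF that]]]
      by (simp add: c_def cinner_diff_right cinner_scaleC_right algebra_simps)
    have "(\<lambda>j. c (j + k) * z ^ j) sums 0" if "z \<noteq> 0" "cmod z < 1" for z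
    proof -
      have "(\<Sum>j<k. c j * z ^ j) = 0"
        using less by (intro sum.neutral) (auto simp: c_def)
      then have "(\<lambda>j. c (j + k) * z ^ (j + k)) sums 0"
        using sums_iff_shift [of "\<lambda>k. c k * z ^ k" k 0] c [OF that(2)] by simp
      from sums_mult2 [OF this, of "inverse (z ^ k)"] show ?thesis
        using that(1) by (simp add: power_add mult.assoc)
    qed
    then have "((\<lambda>_ :: complex. 0) \<longlongrightarrow> c (0 + k)) (at 0)"
      by (intro powser_limit_0_strong [of 1]) auto
    then show ?case
      by (simp add: c_def tendsto_const_iff)
  qed
  then have "a k - b k = 0" for k
    by (metis cinner_self_eq_0)
  then show ?thesis by auto
qed

text \<open>The Hardy space consists of the functions on the disc given by a power series with
  square-summable coefficients. Functions on the unit disc are extended by \<open>0\<close> to the complex plane, so that equality of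
  functions on the disc is equality.\<close>

typedef (overloaded) 'e hardy2 =
  "{f :: complex \<Rightarrow> 'e :: chilbert_space.
      (\<forall>z. 1 \<le> cmod z \<longrightarrow> f z = 0) \<and>
      (\<exists>a. summable (\<lambda>k. (norm (a k))\<^sup>2) \<and> (\<forall>z. cmod z < 1 \<longrightarrow> (\<lambda>k. z ^ k *\<^sub>C a k) sums f z))}"
  morphisms hardy_fun Abs_hardy2
proof (intro exI CollectI conjI allI impI)
  show "summable (\<lambda>k :: nat. (norm (0 :: 'e))\<^sup>2)" by simp
  show "(\<lambda>k. z ^ k *\<^sub>C (0 :: 'e)) sums 0" for z :: complex by simp
qed simp

setup_lifting type_definition_hardy2

definition taylor :: "'e :: chilbert_space hardy2 \<Rightarrow> (nat, 'e) l2" where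
  "taylor f = (THE a. \<forall>z. cmod z < 1 \<longrightarrow> (\<lambda>k. z ^ k *\<^sub>C coord a k) sums hardy_fun f z)"

lemma taylor_eqI:
  assumes "\<And>z. cmod z < 1 \<Longrightarrow> (\<lambda>k. z ^ k *\<^sub>C coord a k) sums hardy_fun f z"
  shows "taylor f = a"
  unfolding taylor_def
proof (rule the_equality)
  show "\<forall>z. cmod z < 1 \<longrightarrow> (\<lambda>k. z ^ k *\<^sub>C coord a k) sums hardy_fun f z"
    using assms by blast
  fix b :: "(nat, 'a) l2"
  assume b: "\<forall>z. cmod z < 1 \<longrightarrow> (\<lambda>k. z ^ k *\<^sub>C coord b k) sums hardy_fun f z"
  have "coord b = coord a"
  proof (rule powser_coeff_unique [of "coord b" "hardy_fun f" "coord a"])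
    fix z :: complex assume z: "cmod z < 1"
    show "(\<lambda>k. z ^ k *\<^sub>C coord b k) sums hardy_fun f z" using b z by blast
    show "(\<lambda>k. z ^ k *\<^sub>C coord a k) sums hardy_fun f z" using z by (rule assms)
  qed
  then show "b = a" by (simp only: coord_inject)
qed

lemma taylor_sums:
  assumes "cmod z < 1"
  shows "(\<lambda>k. z ^ k *\<^sub>C coord (taylor f) k) sums hardy_fun f z"
proof -
  obtain a where a: "summable (\<lambda>k. (norm (a k))\<^sup>2)"
    and s: "\<And>z. cmod z < 1 \<Longrightarrow> (\<lambda>k. z ^ k *\<^sub>C a k) sums hardy_fun f z"
    using hardy_fun [of f] by auto
  have "coord (Abs_l2 a) = a"
    using a by (subst Abs_l2_inverse) (auto simp: summable_on_UNIV_nonneg_real_iff)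
  with s have "\<And>z. cmod z < 1 \<Longrightarrow> (\<lambda>k. z ^ k *\<^sub>C coord (Abs_l2 a) k) sums hardy_fun f z" by simp
  from taylor_eqI [OF this] this assms show ?thesis by simp
qed

lemma summable_coord: "summable (\<lambda>k. (norm (coord (a :: (nat, 'e :: complex_inner) l2) k))\<^sup>2)"
  using coord [of a] by (simp add: summable_on_UNIV_nonneg_real_iff)

lemma hardy2_eqI: "taylor f = taylor g \<Longrightarrow> f = g"
proof -
  assume t: "taylor f = taylor g"
  have "hardy_fun f z = hardy_fun g z" for z
  proof (cases "cmod z < 1")
    case True
    then show ?thesis using taylor_sums [OF True, of f] taylor_sums [OF True, of g] t
      by (simp add: sums_unique2)
  next
    case False
    then show ?thesis using hardy_fun [of f] hardy_fun [of g] by simp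
  qed
  then have "hardy_fun f = hardy_fun g" by (rule ext)
  then show ?thesis by (simp only: hardy_fun_inject)
qed

lemma hardy2_memI:
  fixes f :: "complex \<Rightarrow> 'e :: chilbert_space"
  assumes "\<And>z. 1 \<le> cmod z \<Longrightarrow> f z = 0"
    and "\<And>z. cmod z < 1 \<Longrightarrow> (\<lambda>k. z ^ k *\<^sub>C coord a k) sums f z"
  shows "f \<in> {f.
      (\<forall>z. 1 \<le> cmod z \<longrightarrow> f z = 0) \<and>
      (\<exists>a. summable (\<lambda>k. (norm (a k))\<^sup>2) \<and> (\<forall>z. cmod z < 1 \<longrightarrow> (\<lambda>k. z ^ k *\<^sub>C a k) sums f z))}"
proof -
  have "summable (\<lambda>k. (norm (coord a k))\<^sup>2) \<and>
      (\<forall>z. cmod z < 1 \<longrightarrow> (\<lambda>k. z ^ k *\<^sub>C coord a k) sums f z)"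
    using assms(2) summable_coord by blast
  moreover have "\<forall>z. 1 \<le> cmod z \<longrightarrow> f z = 0"
    using assms(1) by blast
  ultimately show ?thesis by blast
qed

definition hardy_of_coeffs :: "(nat, 'e :: chilbert_space) l2 \<Rightarrow> 'e hardy2" where
  "hardy_of_coeffs a = Abs_hardy2 (\<lambda>z. if cmod z < 1 then \<Sum>k. z ^ k *\<^sub>C coord a k else 0)"

lemma taylor_hardy_of_coeffs [simp]: "taylor (hardy_of_coeffs a) = a"
proof -
  have s: "(\<lambda>k. z ^ k *\<^sub>C coord a k) sums (\<Sum>k. z ^ k *\<^sub>C coord a k)" if "cmod z < 1" for z
  proof (rule summable_sums, rule summable_comparison_test)
    show "summable (\<lambda>k. cmod z ^ k * norm a)"
      using that by (intro summable_mult2 summable_geometric) simp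
    show "\<exists>N. \<forall>k\<ge>N. norm (z ^ k *\<^sub>C coord a k) \<le> cmod z ^ k * norm a"
      by (simp add: norm_power mult_left_mono norm_coord_le)
  qed
  have "hardy_fun (hardy_of_coeffs a) = (\<lambda>z. if cmod z < 1 then \<Sum>k. z ^ k *\<^sub>C coord a k else 0)"
    unfolding hardy_of_coeffs_def
    by (rule Abs_hardy2_inverse, rule hardy2_memI [where a = a]) (simp_all add: s)
  then show ?thesis by (intro taylor_eqI) (simp add: s)
qed

text \<open>The vector operations are pointwise; inner product and norm are those of the sequence of Taylor
  coefficients.\<close>

lemma hardy_fun_outside: "1 \<le> cmod z \<Longrightarrow> hardy_fun f z = 0"
  using hardy_fun [of f] by simp

lemma taylor_sums_add:
  assumes "cmod z < 1"
  shows "(\<lambda>k. z ^ k *\<^sub>C coord (taylor f + taylor g) k) sums (hardy_fun f z + hardy_fun g z)"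
  using sums_add [OF taylor_sums [OF assms, of f] taylor_sums [OF assms, of g]]
  by (simp add: plus_l2.rep_eq scaleC_add_right)

lemma taylor_sums_scaleC:
  assumes "cmod z < 1"
  shows "(\<lambda>k. z ^ k *\<^sub>C coord (c *\<^sub>C taylor f) k) sums (c *\<^sub>C hardy_fun f z)"
  using bounded_linear.sums [OF bounded_linear_scaleC taylor_sums [OF assms, of f], of c]
  by (simp add: scaleC_l2.rep_eq scaleC_scaleC mult.commute)

instantiation hardy2 :: (chilbert_space) complex_inner
begin

lift_definition zero_hardy2 :: "'a hardy2" is "\<lambda>_. 0"
  using hardy2_memI [of "\<lambda>_. 0 :: 'a" 0] by (simp add: zero_l2.rep_eq)
definition plus_hardy2 :: "'a hardy2 \<Rightarrow> 'a hardy2 \<Rightarrow> 'a hardy2" where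
  "plus_hardy2 f g = Abs_hardy2 (\<lambda>z. hardy_fun f z + hardy_fun g z)"
definition scaleC_hardy2 :: "complex \<Rightarrow> 'a hardy2 \<Rightarrow> 'a hardy2" where
  "scaleC_hardy2 c f = Abs_hardy2 (\<lambda>z. c *\<^sub>C hardy_fun f z)"
definition scaleR_hardy2 :: "real \<Rightarrow> 'a hardy2 \<Rightarrow> 'a hardy2" where
  "scaleR_hardy2 r f = complex_of_real r *\<^sub>C f"
definition uminus_hardy2 :: "'a hardy2 \<Rightarrow> 'a hardy2" where
  "uminus_hardy2 f = (- 1) *\<^sub>C f"
definition minus_hardy2 :: "'a hardy2 \<Rightarrow> 'a hardy2 \<Rightarrow> 'a hardy2" where
  "minus_hardy2 f g = f + - g"
definition cinner_hardy2 :: "'a hardy2 \<Rightarrow> 'a hardy2 \<Rightarrow> complex" where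
  "cinner_hardy2 f g = cinner (taylor f) (taylor g)"
definition norm_hardy2 :: "'a hardy2 \<Rightarrow> real" where
  "norm_hardy2 f = norm (taylor f)"
definition "dist_hardy2 (f :: 'a hardy2) g = norm (f - g)"
definition "sgn_hardy2 (f :: 'a hardy2) = inverse (norm f) *\<^sub>R f"
definition "(uniformity :: ('a hardy2 \<times> 'a hardy2) filter) =
  (INF e\<in>{0<..}. principal {(x, y). dist x y < e})"
definition "open_hardy2 (S :: 'a hardy2 set) \<longleftrightarrow>
  (\<forall>x\<in>S. \<forall>\<^sub>F (x', y) in uniformity. x' = x \<longrightarrow> y \<in> S)"

instance
proof
  fix f g h :: "'a hardy2" and a b :: complex and r s :: real
  have t0 [simp]: "taylor (0 :: 'a hardy2) = 0"
    by (rule taylor_eqI) (simp add: zero_hardy2.rep_eq zero_l2.rep_eq)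
  have add [simp]: "taylor (f + g) = taylor f + taylor g" for f g :: "'a hardy2"
    unfolding plus_hardy2_def
    by (rule taylor_eqI, subst Abs_hardy2_inverse, rule hardy2_memI [OF _ taylor_sums_add])
      (simp_all add: hardy_fun_outside taylor_sums_add)
  have scal [simp]: "taylor (c *\<^sub>C f) = c *\<^sub>C taylor f" for c and f :: "'a hardy2"
    unfolding scaleC_hardy2_def
    by (rule taylor_eqI, subst Abs_hardy2_inverse, rule hardy2_memI [OF _ taylor_sums_scaleC])
      (simp_all add: hardy_fun_outside taylor_sums_scaleC)
  have scalr [simp]: "taylor (r *\<^sub>R f) = r *\<^sub>R taylor f" for r and f :: "'a hardy2"
    by (simp add: scaleR_hardy2_def scaleR_scaleC)
  have um [simp]: "taylor (- f) = - taylor f" for f :: "'a hardy2"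
    by (simp add: uminus_hardy2_def complex_vector.scale_minus_left)
  show "f + g + h = f + (g + h)" by (rule hardy2_eqI) (simp add: add.assoc)
  show "f + g = g + f" by (rule hardy2_eqI) (simp add: add.commute)
  show "0 + f = f" by (rule hardy2_eqI) simp
  show "- f + f = 0" by (rule hardy2_eqI) simp
  show "f - g = f + - g" by (rule minus_hardy2_def)
  show "r *\<^sub>R (f + g) = r *\<^sub>R f + r *\<^sub>R g" by (rule hardy2_eqI) (simp add: scaleR_add_right)
  show "(r + s) *\<^sub>R f = r *\<^sub>R f + s *\<^sub>R f" by (rule hardy2_eqI) (simp add: scaleR_add_left)
  show "r *\<^sub>R s *\<^sub>R f = (r * s) *\<^sub>R f" by (rule hardy2_eqI) simp
  show "1 *\<^sub>R f = f" by (rule hardy2_eqI) simp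
  show "a *\<^sub>C (f + g) = a *\<^sub>C f + a *\<^sub>C g" by (rule hardy2_eqI) (simp add: scaleC_add_right)
  show "(a + b) *\<^sub>C f = a *\<^sub>C f + b *\<^sub>C f" by (rule hardy2_eqI) (simp add: scaleC_add_left)
  show "a *\<^sub>C b *\<^sub>C f = (a * b) *\<^sub>C f" by (rule hardy2_eqI) (simp add: scaleC_scaleC)
  show "r *\<^sub>R f = complex_of_real r *\<^sub>C f" by (rule scaleR_hardy2_def)
  show "dist f g = norm (f - g)" by (rule dist_hardy2_def)
  show "sgn f = inverse (norm f) *\<^sub>R f" by (rule sgn_hardy2_def)
  show "(uniformity :: ('a hardy2 \<times> 'a hardy2) filter) =
    (INF e\<in>{0<..}. principal {(x, y). dist x y < e})" by (rule uniformity_hardy2_def)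
  show "open S \<longleftrightarrow> (\<forall>x\<in>S. \<forall>\<^sub>F (x', y) in uniformity. x' = x \<longrightarrow> y \<in> S)" for S :: "'a hardy2 set"
    by (rule open_hardy2_def)
  show "norm f = 0 \<longleftrightarrow> f = 0"
    unfolding norm_hardy2_def using hardy2_eqI [of f 0] by auto
  show "norm (f + g) \<le> norm f + norm g" by (simp add: norm_hardy2_def norm_triangle_ineq)
  show "norm (a *\<^sub>C f) = cmod a * norm f" by (simp add: norm_hardy2_def)
  show "norm (r *\<^sub>R f) = \<bar>r\<bar> * norm f" by (simp add: norm_hardy2_def)
  show "cinner f g = cnj (cinner g f)" unfolding cinner_hardy2_def by (rule cinner_commute)
  show "cinner f (g + h) = cinner f g + cinner f h"
    by (simp add: cinner_hardy2_def cinner_add_right)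
  show "cinner f (a *\<^sub>C g) = a * cinner f g"
    by (simp add: cinner_hardy2_def cinner_scaleC_right)
  show "cinner f f = complex_of_real ((norm f)\<^sup>2)"
    by (simp add: cinner_hardy2_def norm_hardy2_def cinner_self)
qed

end

lemma hardy_fun_add: "hardy_fun (f + g) z = hardy_fun f z + hardy_fun g z"
  unfolding plus_hardy2_def
  by (subst Abs_hardy2_inverse, rule hardy2_memI [OF _ taylor_sums_add])
    (simp_all add: hardy_fun_outside)

lemma hardy_fun_scaleC: "hardy_fun (c *\<^sub>C f) z = c *\<^sub>C hardy_fun f z"
  unfolding scaleC_hardy2_def
  by (subst Abs_hardy2_inverse, rule hardy2_memI [OF _ taylor_sums_scaleC])
    (simp_all add: hardy_fun_outside)

lemma taylor_add: "taylor (f + g) = taylor f + taylor g"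
  by (rule taylor_eqI) (simp add: hardy_fun_add taylor_sums_add)

lemma taylor_scaleC: "taylor (c *\<^sub>C f) = c *\<^sub>C taylor f"
  by (rule taylor_eqI) (simp add: hardy_fun_scaleC taylor_sums_scaleC)

lemma taylor_diff: "taylor (f - g) = taylor f - taylor g"
  by (metis taylor_add diff_add_cancel eq_diff_eq)

instance hardy2 :: (chilbert_space) chilbert_space
proof
  fix X :: "nat \<Rightarrow> 'a hardy2"
  assume "Cauchy X"
  then have "Cauchy (\<lambda>k. taylor (X k))"
    by (simp add: Cauchy_def dist_norm norm_hardy2_def taylor_diff)
  then obtain l where "(\<lambda>k. taylor (X k)) \<longlonglongrightarrow> l"
    using Cauchy_convergent convergent_def by blast
  then have "X \<longlonglongrightarrow> hardy_of_coeffs l"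
    by (simp add: lim_sequentially dist_norm norm_hardy2_def taylor_diff)
  then show "convergent X" by (auto simp: convergent_def)
qed

text \<open>Analyticity is complex differentiability in the operator norm.\<close>

definition hardy_inf :: "(complex \<Rightarrow> 'e :: chilbert_space \<Rightarrow>\<^sub>L 'e) set" where
  "hardy_inf = {\<Theta>.
     (\<forall>z. 1 \<le> cmod z \<longrightarrow> \<Theta> z = 0) \<and>
     (\<forall>z. cmod z < 1 \<longrightarrow> clinear_blinfun (\<Theta> z)) \<and>
     (\<forall>z. cmod z < 1 \<longrightarrow> (\<exists>D. (\<Theta> has_derivative (\<lambda>h. h *\<^sub>C D)) (at z))) \<and>
     (\<exists>K. \<forall>z. cmod z < 1 \<longrightarrow> norm (\<Theta> z) \<le> K)}"

text \<open>Meaningful for \<open>\<Theta> \<in> hardy_inf\<close>, in which case the pointwise product is again in the Hardy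
  space.\<close>

definition mult_op :: "(complex \<Rightarrow> 'e :: chilbert_space \<Rightarrow>\<^sub>L 'e) \<Rightarrow> 'e hardy2 \<Rightarrow> 'e hardy2" where
  "mult_op \<Theta> f = Abs_hardy2 (\<lambda>z. blinfun_apply (\<Theta> z) (hardy_fun f z))"

end

theory Submission
  imports Defs
begin

text \<open>All subspaces involved are spaces of families supported on a set of words, so complements and
  projections are complements of word sets and restrictions. On \<open>\<N>\<close> the odometer map permutes
  coordinates along the bijection of words that adds \<open>1\<close> with carry. Since
  \<open>W\<^sub>1\<^sub>2 (e\<^sub>n\<^sup>m \<otimes> \<eta>) = e\<^sub>1\<^sup>m \<otimes> P\<^sub>\<M> L \<eta>\<close>, a nonzero \<open>P\<^sub>\<M> L \<eta>\<close> yields a sequence that is triangular with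
  respect to the number of leading letters \<open>1\<close>, hence independent. Finally \<open>W\<^sub>2\<^sub>2 V\<close> maps
  \<open>e\<^sub>1\<^sup>p \<otimes> \<eta>\<close> to \<open>\<Sum>\<^sub>r e\<^sub>1\<^sup>p\<^sup>+\<^sup>r \<otimes> L\<^sub>r \<eta>\<close>, which in the Hardy space is multiplication by \<open>\<Theta>\<close>.\<close>

section \<open>Families supported on a set of indices\<close>

text \<open>The index type is left arbitrary: words index the Fock space, natural numbers the Taylor
  coefficients of Hardy functions.\<close>

definition l2_on :: "'i set \<Rightarrow> ('i, 'e :: complex_inner) l2 set" where
  "l2_on A = {f. \<forall>i. i \<notin> A \<longrightarrow> coord f i = 0}"

lemma l2_eqI: "(\<And>i. coord f i = coord g i) \<Longrightarrow> f = g"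
  by (metis coord_inject ext)

lemma subspace_l2_on: "complex_vector.subspace (l2_on A)"
  unfolding complex_vector.subspace_def l2_on_def
  by (auto simp: zero_l2.rep_eq plus_l2.rep_eq scaleC_l2.rep_eq)

lemma closed_l2_on: "closed (l2_on A :: ('i, 'e :: complex_inner) l2 set)"
proof -
  have "closed {f :: ('i, 'e) l2. i \<notin> A \<longrightarrow> coord f i = 0}" for i
    by (cases "i \<in> A")
      (auto intro!: closed_Collect_eq linear_continuous_on bounded_linear_coord continuous_on_const)
  then show ?thesis unfolding l2_on_def Collect_all_eq by (intro closed_INT) auto
qed

lemma ebasis_zero [simp]: "ebasis i 0 = 0"
  by transfer auto

lemma ebasis_in_l2_on: "i \<in> A \<Longrightarrow> ebasis i x \<in> l2_on A"
  by (auto simp: l2_on_def ebasis.rep_eq)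

lemma ebasis_coord_in_l2_on: "f \<in> l2_on A \<Longrightarrow> ebasis i (coord f i) \<in> l2_on A"
  by (cases "i \<in> A")
    (simp_all add: ebasis_in_l2_on, simp add: l2_on_def zero_l2.rep_eq)

text \<open>The generators lie in \<open>l2_on A\<close>, a closed subspace. Conversely, finite
  truncations approximate a family, and their terms at indices outside \<open>A\<close>
  vanish.\<close>

lemma closure_span_ebasis:
  "closure (complex_vector.span {ebasis i x | i (x :: 'e :: complex_inner). i \<in> A}) = l2_on A"
proof
  let ?S = "{ebasis i x | i (x :: 'e). i \<in> A}"
  show "closure (complex_vector.span ?S) \<subseteq> l2_on A"
    by (intro closure_minimal complex_vector.span_minimal subspace_l2_on closed_l2_on)
      (auto intro: ebasis_in_l2_on)
  show "l2_on A \<subseteq> closure (complex_vector.span ?S)"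
  proof
    fix f :: "('a, 'e) l2" assume f: "f \<in> l2_on A"
    show "f \<in> closure (complex_vector.span ?S)"
      unfolding closure_approachable
    proof (intro allI impI)
      fix e :: real assume "e > 0"
      then obtain F where F: "finite F" "norm (f - (\<Sum>i\<in>F. ebasis i (coord f i))) < e"
        by (rule ebasis_approx)
      have "ebasis i (coord f i) \<in> complex_vector.span ?S" for i
        using f by (cases "i \<in> A")
          (auto simp: l2_on_def complex_vector.span_zero intro!: complex_vector.span_base)
      then have "(\<Sum>i\<in>F. ebasis i (coord f i)) \<in> complex_vector.span ?S"
        by (intro complex_vector.span_sum)
      then show "\<exists>y\<in>complex_vector.span ?S. dist y f < e"
        using F(2) by (auto simp: dist_norm norm_minus_commute)
    qed
  qed
qed

lemma cinner_ebasis_left: "cinner (ebasis i x) f = cinner x (coord f i)"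
proof transfer
  fix i :: 'a and x :: 'b and f
  have "(\<Sum>\<^sub>\<infinity>j. cinner (if j = i then x else 0) (f j)) =
      (\<Sum>\<^sub>\<infinity>j\<in>{i}. cinner (if j = i then x else 0) (f j))"
    by (rule infsum_cong_neutral) auto
  then show "(\<Sum>\<^sub>\<infinity>j. cinner (if j = i then x else 0) (f j)) = cinner x (f i)"
    by simp
qed

lemma cinner_l2_on_disjoint:
  assumes "f \<in> l2_on A" "g \<in> l2_on B" "A \<inter> B = {}"
  shows "cinner f g = 0"
proof -
  have "cinner (coord f i) (coord g i) = 0" for i
    using assms by (cases "i \<in> A") (auto simp: l2_on_def)
  then show ?thesis by (simp add: cinner_l2.rep_eq)
qed

text \<open>An explicit formula for the orthogonal projection onto \<open>l2_on A\<close>, which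
  \<open>orth_proj\<close> gives only as a definite description.\<close>

lift_definition l2_restrict :: "'i set \<Rightarrow> ('i, 'e :: complex_inner) l2 \<Rightarrow> ('i, 'e) l2"
  is "\<lambda>A f i. if i \<in> A then f i else 0"
proof -
  fix A :: "'i set" and f :: "'i \<Rightarrow> 'e" assume f: "(\<lambda>i. (norm (f i))\<^sup>2) summable_on UNIV"
  show "(\<lambda>i. (norm (if i \<in> A then f i else 0))\<^sup>2) summable_on UNIV"
    by (rule summable_on_comparison_test [OF f]) auto
qed

lemma l2_restrict_in: "l2_restrict A f \<in> l2_on A"
  by (simp add: l2_on_def l2_restrict.rep_eq)

lemma l2_restrict_l2_on_sum:
  assumes "f \<in> l2_on (A \<union> B)" "A \<inter> B = {}"
  shows "f = l2_restrict A f + l2_restrict B f"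
  using assms by (intro l2_eqI) (auto simp: l2_on_def l2_restrict.rep_eq plus_l2.rep_eq)

lemma orth_decomposition_l2_on:
  assumes "A \<inter> B = {}"
  shows "orth_decomposition (l2_on (A \<union> B) :: ('i, 'e :: complex_inner) l2 set) (l2_on A) (l2_on B)"
proof -
  have "(l2_on (A \<union> B) :: ('i, 'e) l2 set) = {x + y |x y. x \<in> l2_on A \<and> y \<in> l2_on B}"
  proof (intro equalityI subsetI)
    fix f :: "('i, 'e) l2" assume "f \<in> l2_on (A \<union> B)"
    from l2_restrict_l2_on_sum [OF this assms]
    show "f \<in> {x + y |x y. x \<in> l2_on A \<and> y \<in> l2_on B}"
      using l2_restrict_in by blast
  qed (auto simp: l2_on_def plus_l2.rep_eq)
  then show ?thesis
    unfolding orth_decomposition_def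
    using assms by (auto simp: subspace_l2_on closed_l2_on cinner_l2_on_disjoint)
qed

lemma ocomplement_l2_on: "ocomplement (l2_on C) (l2_on A) = l2_on (C - A)"
proof (intro equalityI subsetI)
  fix f assume f: "f \<in> ocomplement (l2_on C) (l2_on A)"
  have "coord f i = 0" if "i \<in> A" for i
  proof -
    \<comment> \<open>With this test vector, orthogonality says that the squared norm of the
      coordinate at \<open>i\<close> is zero.\<close>
    have "cinner (ebasis i (coord f i)) f = 0"
      using f ebasis_in_l2_on [OF that] by (auto simp: ocomplement_def)
    then show ?thesis by (simp add: cinner_ebasis_left)
  qed
  then show "f \<in> l2_on (C - A)"
    using f by (auto simp: ocomplement_def l2_on_def)
next
  fix f assume f: "f \<in> l2_on (C - A)"
  then show "f \<in> ocomplement (l2_on C) (l2_on A)"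
    using cinner_l2_on_disjoint [OF _ f] by (auto simp: ocomplement_def l2_on_def)
qed

text \<open>The remainder is orthogonal to \<open>l2_on A\<close> by disjointness of supports. For
  uniqueness, the remainder is tested against its own coordinates in \<open>A\<close>.\<close>

lemma orth_proj_l2_on: "orth_proj (l2_on A) f = l2_restrict A f"
  unfolding orth_proj_def
proof (rule the_equality)
  have "f - l2_restrict A f \<in> l2_on (- A)"
    by (simp add: l2_on_def l2_restrict.rep_eq minus_l2.rep_eq)
  then show "l2_restrict A f \<in> l2_on A \<and> (\<forall>w\<in>l2_on A. cinner w (f - l2_restrict A f) = 0)"
    by (simp add: l2_restrict_in cinner_l2_on_disjoint [where B = "- A"])
  fix g assume g: "g \<in> l2_on A \<and> (\<forall>w\<in>l2_on A. cinner w (f - g) = 0)"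
  have "coord g i = coord f i" if "i \<in> A" for i
  proof -
    have "cinner (ebasis i (coord (f - g) i)) (f - g) = 0"
      using g ebasis_in_l2_on [OF that] by auto
    then show ?thesis by (simp add: cinner_ebasis_left minus_l2.rep_eq)
  qed
  then show "g = l2_restrict A f"
    using g by (intro l2_eqI) (auto simp: l2_restrict.rep_eq l2_on_def)
qed

section \<open>Norm bounds and bounded operators on spaces of families\<close>

lemma norm_eq_of_cinner: "cinner x x = cinner y y \<Longrightarrow> norm x = norm y"
  by (simp add: cinner_self flip: of_real_power)

lemma norm_l2_restrict_le: "norm (l2_restrict A f) \<le> norm f"
  unfolding norm_l2.rep_eq
  using coord [of f] coord [of "l2_restrict A f"]
  by (auto intro!: infsum_mono simp: l2_restrict.rep_eq)

lemma bounded_clinear_on_l2_restrict: "bounded_clinear_on S (l2_on A) (l2_restrict A)"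
  unfolding bounded_clinear_on_def
  by (auto simp: l2_restrict_in l2_restrict.rep_eq plus_l2.rep_eq scaleC_l2.rep_eq norm_l2_restrict_le
      intro!: l2_eqI exI [of _ 1])

lemma bounded_clinear_on_compose:
  assumes "bounded_clinear_on S R T" "bounded_clinear_on R Q T'"
  shows "bounded_clinear_on S Q (\<lambda>x. T' (T x))"
proof -
  obtain K where K: "\<And>x. x \<in> S \<Longrightarrow> norm (T x) \<le> K * norm x"
    using assms(1) unfolding bounded_clinear_on_def by blast
  obtain K' where K': "\<And>x. x \<in> R \<Longrightarrow> norm (T' x) \<le> K' * norm x"
    using assms(2) unfolding bounded_clinear_on_def by blast
  have "norm (T' (T x)) \<le> (\<bar>K'\<bar> * K) * norm x" if "x \<in> S" for x
  proof -
    have "norm (T' (T x)) \<le> K' * norm (T x)"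
      using assms(1) that by (auto simp: bounded_clinear_on_def intro: K')
    also have "\<dots> \<le> \<bar>K'\<bar> * norm (T x)" by (intro mult_right_mono) auto
    also have "\<dots> \<le> \<bar>K'\<bar> * (K * norm x)" by (intro mult_left_mono K that) auto
    finally show ?thesis by (simp add: mult.assoc)
  qed
  then show ?thesis
    using assms unfolding bounded_clinear_on_def by metis
qed

lemma bounded_clinear_on_subset:
  "bounded_clinear_on S R T \<Longrightarrow> S' \<subseteq> S \<Longrightarrow> R \<subseteq> R' \<Longrightarrow> bounded_clinear_on S' R' T"
  unfolding bounded_clinear_on_def by blast

text \<open>Operators are functions on the whole type of which only the restriction to
  \<open>S\<close> counts. That \<open>S\<close> is a subspace keeps sums and multiples where
  \<open>T\<close> and \<open>T'\<close> agree.\<close>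

lemma bounded_clinear_on_cong:
  assumes "bounded_clinear_on S R T" "complex_vector.subspace S" "\<And>x. x \<in> S \<Longrightarrow> T' x = T x"
  shows "bounded_clinear_on S R T'"
  using assms unfolding bounded_clinear_on_def complex_vector.subspace_def by auto

lemma bounded_clinear_on_coord: "bounded_clinear_on S UNIV (\<lambda>f. coord f i)"
  unfolding bounded_clinear_on_def
  by (auto simp: plus_l2.rep_eq scaleC_l2.rep_eq norm_coord_le intro!: exI [of _ 1])

text \<open>Density of the finite sums of elementary tensors: the operators agree on a truncation of
  \<open>f\<close> by linearity, and boundedness makes both small on the remainder. This reduces
  every later operator identity to elementary tensors.\<close>

lemma bounded_clinear_on_l2_eqI:
  assumes S: "bounded_clinear_on (l2_on A) R S" and T: "bounded_clinear_on (l2_on A) R' T"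
    and eq: "\<And>i x. i \<in> A \<Longrightarrow> S (ebasis i x) = T (ebasis i x)"
    and f: "f \<in> l2_on A"
  shows "S f = T f"
proof -
  obtain K where K: "\<And>x. x \<in> l2_on A \<Longrightarrow> norm (S x) \<le> K * norm x"
    using S unfolding bounded_clinear_on_def by blast
  obtain K' where K': "\<And>x. x \<in> l2_on A \<Longrightarrow> norm (T x) \<le> K' * norm x"
    using T unfolding bounded_clinear_on_def by blast
  have S_add: "S (x + y) = S x + S y" and T_add: "T (x + y) = T x + T y"
    if "x \<in> l2_on A" "y \<in> l2_on A" for x y
    using S T that unfolding bounded_clinear_on_def by auto
  have zero: "(0 :: ('a, 'b) l2) \<in> l2_on A"
    by (rule complex_vector.subspace_0 [OF subspace_l2_on])
  have S0: "S 0 = 0" and T0: "T 0 = 0"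
    using S_add [OF zero zero] T_add [OF zero zero] by simp_all
  have "norm (S f - T f) \<le> e" if "e > 0" for e
  proof -
    \<comment> \<open>The bounds \<open>K\<close> and \<open>K'\<close> may be negative or zero;
      absolute values and the summand 1 make the denominator positive.\<close>
    define d where "d = e / (\<bar>K\<bar> + \<bar>K'\<bar> + 1)"
    have "d > 0" using that by (simp add: d_def add_nonneg_pos)
    then obtain F where F: "finite F" "norm (f - (\<Sum>i\<in>F. ebasis i (coord f i))) < d"
      by (rule ebasis_approx)
    define g where "g F = (\<Sum>i\<in>F. ebasis i (coord f i))" for F
    have g: "g F \<in> l2_on A" for F
      unfolding g_def
      by (intro complex_vector.subspace_sum subspace_l2_on ebasis_coord_in_l2_on f)
    have Sg: "S (g F) = T (g F)"
      using F(1)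
    proof induction
      case empty
      then show ?case by (simp add: g_def S0 T0)
    next
      case (insert i F)
      have "S (ebasis i (coord f i)) = T (ebasis i (coord f i))"
        using f by (cases "i \<in> A") (auto simp: eq l2_on_def S0 T0)
      moreover have "g (insert i F) = ebasis i (coord f i) + g F"
        using insert by (simp add: g_def)
      ultimately show ?case
        using insert.IH by (simp add: S_add T_add g ebasis_coord_in_l2_on f)
    qed
    define h where "h = f - g F"
    \<comment> \<open>Linearity and the norm bounds are available only on \<open>l2_on A\<close>, so
      the remainder has to stay there.\<close>
    have h: "h \<in> l2_on A" unfolding h_def
      by (intro complex_vector.subspace_diff subspace_l2_on f g)
    have fh: "f = h + g F" by (simp add: h_def)
    have "S f - T f = S h - T h"
      unfolding fh using h g Sg by (simp add: S_add T_add)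
    also have "norm \<dots> \<le> norm (S h) + norm (T h)" by (rule norm_triangle_ineq4)
    also have "\<dots> \<le> K * norm h + K' * norm h" by (intro add_mono K K' h)
    also have "\<dots> \<le> (\<bar>K\<bar> + \<bar>K'\<bar> + 1) * norm h"
      unfolding distrib_right [symmetric] by (intro mult_right_mono) auto
    also have "\<dots> \<le> (\<bar>K\<bar> + \<bar>K'\<bar> + 1) * d"
      using F(2) by (intro mult_left_mono) (auto simp: h_def g_def)
    also have "\<dots> = e"
    proof -
      have "\<bar>K\<bar> + \<bar>K'\<bar> + 1 > 0" by (simp add: add_nonneg_pos)
      then show ?thesis by (simp add: d_def)
    qed
    finally show ?thesis .
  qed
  then have "norm (S f - T f) \<le> 0" by (rule field_le_epsilon [of _ 0, simplified])
  then show ?thesis by simp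
qed

section \<open>Unitaries induced by bijections of index sets\<close>

text \<open>A pullback: \<sigma> runs from the new indices to the old ones, so a bijection of words
  enters through its inverse. Injectivity of \<sigma> on \<open>B\<close> ensures square-summability
  of the family given to \<open>Abs_l2\<close>.\<close>

definition reindex :: "('j \<Rightarrow> 'i) \<Rightarrow> 'j set \<Rightarrow> ('i, 'e :: complex_inner) l2 \<Rightarrow> ('j, 'e) l2" where
  "reindex \<sigma> B f = Abs_l2 (\<lambda>j. if j \<in> B then coord f (\<sigma> j) else 0)"

lemma coord_reindex:
  assumes "inj_on \<sigma> B"
  shows "coord (reindex \<sigma> B f) j = (if j \<in> B then coord f (\<sigma> j) else 0)"
proof -
  have "(\<lambda>i. (norm (coord f i))\<^sup>2) summable_on \<sigma> ` B"
    using coord [of f] by (auto intro: summable_on_subset)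
  then have "(\<lambda>j. (norm (coord f (\<sigma> j)))\<^sup>2) summable_on B"
    using assms by (simp add: summable_on_reindex o_def)
  then have "(\<lambda>j. (norm (if j \<in> B then coord f (\<sigma> j) else 0))\<^sup>2) summable_on UNIV"
    by (subst summable_on_cong_neutral [where T = B and g = "\<lambda>j. (norm (coord f (\<sigma> j)))\<^sup>2"]) auto
  then show ?thesis
    unfolding reindex_def by (subst Abs_l2_inverse) auto
qed

lemma unitary_on_bounded: "unitary_on S R U \<Longrightarrow> bounded_clinear_on S R U"
  by (simp add: unitary_on_def)

lemma unitary_on_norm: "unitary_on S R U \<Longrightarrow> x \<in> S \<Longrightarrow> norm (U x) = norm x"
  by (auto simp: unitary_on_def intro: norm_eq_of_cinner)

text \<open>Preservation of the inner product yields the norm bound with constant 1.\<close>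

lemma unitary_onI:
  assumes "\<And>x y. x \<in> S \<Longrightarrow> y \<in> S \<Longrightarrow> U (x + y) = U x + U y"
    and "\<And>c x. x \<in> S \<Longrightarrow> U (c *\<^sub>C x) = c *\<^sub>C U x"
    and "U ` S = R"
    and cin: "\<And>x y. x \<in> S \<Longrightarrow> y \<in> S \<Longrightarrow> cinner (U x) (U y) = cinner x y"
  shows "unitary_on S R U"
proof -
  have "norm (U x) \<le> 1 * norm x" if "x \<in> S" for x
    using norm_eq_of_cinner [OF cin [OF that that]] by simp
  then show ?thesis
    using assms unfolding unitary_on_def bounded_clinear_on_def by blast
qed

lemma unitary_on_compose:
  assumes "unitary_on S R U" "unitary_on R Q U'"
  shows "unitary_on S Q (\<lambda>x. U' (U x))"
proof -
  have "(\<lambda>x. U' (U x)) ` S = Q"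
    using assms unfolding unitary_on_def by (metis image_image)
  moreover have "bounded_clinear_on S Q (\<lambda>x. U' (U x))"
    using assms unfolding unitary_on_def by (blast intro: bounded_clinear_on_compose)
  moreover have "U x \<in> R" if "x \<in> S" for x
    using assms(1) that unfolding unitary_on_def by blast
  ultimately show ?thesis
    using assms unfolding unitary_on_def by simp
qed

lemma unitary_on_cong:
  assumes "unitary_on S R U" "complex_vector.subspace S" "\<And>x. x \<in> S \<Longrightarrow> U' x = U x"
  shows "unitary_on S R U'"
  using assms bounded_clinear_on_cong [of S R U U'] unfolding unitary_on_def
  by (auto cong: image_cong)

text \<open>Inner products agree by a change of the summation variable; the inverse bijection
  provides preimages.\<close>

lemma unitary_on_reindex:
  fixes \<sigma> :: "'j \<Rightarrow> 'i"
  assumes \<sigma>: "bij_betw \<sigma> B A"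
  shows "unitary_on (l2_on A) (l2_on B) (reindex \<sigma> B :: ('i, 'e :: complex_inner) l2 \<Rightarrow> ('j, 'e) l2)"
proof (rule unitary_onI)
  have inj: "inj_on \<sigma> B" using \<sigma> by (rule bij_betw_imp_inj_on)
  note co = coord_reindex [OF inj]
  fix f g :: "('i, 'e) l2" and c
  show "reindex \<sigma> B (f + g) = reindex \<sigma> B f + reindex \<sigma> B g"
    by (rule l2_eqI) (simp add: co plus_l2.rep_eq)
  show "reindex \<sigma> B (c *\<^sub>C f) = c *\<^sub>C reindex \<sigma> B f"
    by (rule l2_eqI) (simp add: co scaleC_l2.rep_eq)
  show "cinner (reindex \<sigma> B f) (reindex \<sigma> B g) = cinner f g" if f: "f \<in> l2_on A"
  proof -
    have "cinner (reindex \<sigma> B f) (reindex \<sigma> B g) =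
        (\<Sum>\<^sub>\<infinity>j\<in>B. cinner (coord f (\<sigma> j)) (coord g (\<sigma> j)))"
      unfolding cinner_l2.rep_eq by (rule infsum_cong_neutral) (auto simp: co)
    also have "\<dots> = (\<Sum>\<^sub>\<infinity>i\<in>A. cinner (coord f i) (coord g i))"
      using infsum_reindex [OF inj, of "\<lambda>i. cinner (coord f i) (coord g i)"] \<sigma>
      by (simp add: o_def bij_betw_def)
    also have "\<dots> = cinner f g"
      unfolding cinner_l2.rep_eq using f
      by (intro infsum_cong_neutral) (auto simp: l2_on_def)
    finally show ?thesis .
  qed
next
  have inj: "inj_on \<sigma> B" using \<sigma> by (rule bij_betw_imp_inj_on)
  have \<tau>: "bij_betw (inv_into B \<sigma>) A B" by (rule bij_betw_inv_into [OF \<sigma>])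
  have "f \<in> reindex \<sigma> B ` l2_on A" if f: "f \<in> l2_on B" for f :: "('j, 'e) l2"
  proof (rule image_eqI)
    show "reindex (inv_into B \<sigma>) A f \<in> l2_on A"
      by (auto simp: l2_on_def coord_reindex [OF bij_betw_imp_inj_on [OF \<tau>]])
    show "f = reindex \<sigma> B (reindex (inv_into B \<sigma>) A f)"
      using f bij_betwE [OF \<sigma>]
      by (intro l2_eqI) (auto simp: l2_on_def coord_reindex [OF bij_betw_imp_inj_on [OF \<tau>]]
          coord_reindex [OF inj] inv_into_f_f [OF inj])
  qed
  then show "reindex \<sigma> B ` l2_on A = (l2_on B :: ('j, 'e) l2 set)"
    by (auto simp: l2_on_def coord_reindex [OF inj])
qed

section \<open>Words and the odometer\<close>

lemma fock_eq_l2_on: "fock n = l2_on (words n)"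
  by (auto simp: fock_def l2_on_def)

lemma replicate_in_words: "n \<ge> 1 \<Longrightarrow> replicate k 1 \<in> words n" "n \<ge> 1 \<Longrightarrow> replicate k n \<in> words n"
  by (auto simp: words_def in_lists_conv_set)

text \<open>The empty word is \<open>replicate 0 c\<close>, so removing the constant words also
  accounts for the condition on the length.\<close>

lemma nonconstant_words_eq:
  "{\<mu> \<in> words n. length \<mu> \<ge> 1 \<and> (\<exists>i<length \<mu>. \<mu> ! i \<noteq> c)} = words n - range (\<lambda>k. replicate k c)"
proof -
  have "\<mu> \<in> range (\<lambda>k. replicate k c) \<longleftrightarrow> (\<forall>i<length \<mu>. \<mu> ! i = c)" for \<mu>
  proof
    assume "\<forall>i<length \<mu>. \<mu> ! i = c"
    then have "\<mu> = replicate (length \<mu>) c" by (simp add: list_eq_iff_nth_eq)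
    then show "\<mu> \<in> range (\<lambda>k. replicate k c)" by blast
  qed auto
  then show ?thesis by auto
qed

lemma
  space_M_eq: "space_M n = l2_on (words n - range (\<lambda>k. replicate k 1))" and
  space_N_eq: "space_N n = l2_on (words n - range (\<lambda>k. replicate k n))"
  unfolding space_M_def space_N_def nonconstant_words_eq [symmetric] closure_span_ebasis [symmetric]
  by (simp_all only: mem_Collect_eq)

text \<open>By \<open>n \<ge> 1\<close> the letters 1 and \<open>n\<close> belong to the alphabet,
  so all their powers are words and the complement of the nonconstant words is the full set of
  powers.\<close>

lemma
  assumes "n \<ge> 1"
  shows space_M_perp_eq: "space_M_perp n = l2_on (range (\<lambda>k. replicate k 1))"
    and space_N_perp_eq: "space_N_perp n = l2_on (range (\<lambda>k. replicate k n))"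
proof -
  have "range (\<lambda>k. replicate k 1) \<subseteq> words n" "range (\<lambda>k. replicate k n) \<subseteq> words n"
    using replicate_in_words [OF assms] by blast+
  then show "space_M_perp n = l2_on (range (\<lambda>k. replicate k 1))"
    "space_N_perp n = l2_on (range (\<lambda>k. replicate k n))"
    unfolding space_M_perp_def space_N_perp_def fock_eq_l2_on space_M_eq space_N_eq ocomplement_l2_on
    by (simp_all only: double_diff order_refl)
qed

text \<open>This normal form replaces the least index in \<open>odometer_word\<close>;
  \<open>first_neq_unique\<close> shows that it is unique.\<close>

lemma list_split_at_first_neq:
  assumes "\<mu> \<notin> range (\<lambda>k. replicate k c)"
  obtains k a \<rho> where "\<mu> = replicate k c @ a # \<rho>" "a \<noteq> c"
proof -
  have "\<not> (\<forall>x\<in>set \<mu>. x = c)"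
    using assms replicate_length_same [of \<mu> c] by (metis rangeI)
  then have "dropWhile (\<lambda>x. x = c) \<mu> \<noteq> []"
    by simp
  then obtain a \<rho> where a: "dropWhile (\<lambda>x. x = c) \<mu> = a # \<rho>" by (cases "dropWhile (\<lambda>x. x = c) \<mu>") auto
  then have neq: "a \<noteq> c" using hd_dropWhile [of "\<lambda>x. x = c" \<mu>] by simp
  have tw: "takeWhile (\<lambda>x. x = c) \<mu> = replicate (length (takeWhile (\<lambda>x. x = c) \<mu>)) c"
    by (rule replicate_length_same [symmetric]) (auto dest: set_takeWhileD)
  have "\<mu> = replicate (length (takeWhile (\<lambda>x. x = c) \<mu>)) c @ a # \<rho>"
    unfolding tw [symmetric] using takeWhile_dropWhile_id [of "\<lambda>x. x = c" \<mu>] a by simp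
  from that [OF this neq] show thesis .
qed

lemma first_neq_unique:
  assumes "replicate k c @ a # \<rho> = replicate l c @ b # \<sigma>" "a \<noteq> c" "b \<noteq> c"
  shows "k = l \<and> a = b \<and> \<rho> = \<sigma>"
  using assms
proof (induction k arbitrary: l)
  case 0
  then show ?case by (cases l) auto
next
  case (Suc k)
  then show ?case by (cases l) auto
qed

lemma append_neq_notin_replicate:
  assumes "a \<noteq> c"
  shows "replicate k c @ a # \<rho> \<notin> range (\<lambda>k. replicate k c)"
proof
  assume "replicate k c @ a # \<rho> \<in> range (\<lambda>k. replicate k c)"
  then obtain j where "replicate k c @ a # \<rho> = replicate j c" by auto
  then have "a \<in> set (replicate j c)" by (metis in_set_conv_decomp)
  then show False using assms by simp
qed

lemma odometer_word_split:
  assumes "a \<noteq> n"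
  shows "odometer_word n (replicate k n @ a # \<rho>) = replicate k 1 @ (a + 1) # \<rho>"
proof -
  have "(LEAST i. i < length (replicate k n @ a # \<rho>) \<and> (replicate k n @ a # \<rho>) ! i \<noteq> n) = k"
    using assms by (intro Least_equality) (auto simp: nth_append not_less [symmetric])
  moreover have "(replicate k n @ a # \<rho>) ! k = a" by (simp add: nth_append)
  ultimately show ?thesis by (simp add: odometer_word_def)
qed

text \<open>In normal form the map replaces the prefix \<open>n^k\<close> by \<open>1^k\<close> and
  the next letter \<open>a\<close> by \<open>a + 1\<close>. It is undone by splitting at the first
  letter different from 1 and lowering that letter.\<close>

lemma odometer_word_bij:
  "bij_betw (odometer_word n) (words n - range (\<lambda>k. replicate k n))
     (words n - range (\<lambda>k. replicate k 1))"
  unfolding bij_betw_def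
proof (intro conjI inj_onI equalityI subsetI)
  fix \<mu> \<nu>
  assume "\<mu> \<in> words n - range (\<lambda>k. replicate k n)" "\<nu> \<in> words n - range (\<lambda>k. replicate k n)"
    and eq: "odometer_word n \<mu> = odometer_word n \<nu>"
  then have w: "\<mu> \<in> words n" "\<nu> \<in> words n" and
    r: "\<mu> \<notin> range (\<lambda>k. replicate k n)" "\<nu> \<notin> range (\<lambda>k. replicate k n)" by auto
  obtain k a \<rho> where m: "\<mu> = replicate k n @ a # \<rho>" "a \<noteq> n"
    by (rule list_split_at_first_neq [OF r(1)])
  obtain l b \<sigma> where v: "\<nu> = replicate l n @ b # \<sigma>" "b \<noteq> n"
    by (rule list_split_at_first_neq [OF r(2)])
  \<comment> \<open>Letters are at least 1, so the raised letter is the first one different from 1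
    and the splitting of the image is unique.\<close>
  have "a + 1 \<noteq> 1" "b + 1 \<noteq> 1" using w m v by (auto simp: words_def)
  then show "\<mu> = \<nu>"
    using eq first_neq_unique [of k 1 "a + 1" \<rho> l "b + 1" \<sigma>] m v
    by (auto simp: odometer_word_split)
next
  fix \<nu> assume "\<nu> \<in> odometer_word n ` (words n - range (\<lambda>k. replicate k n))"
  then obtain \<mu> where w: "\<mu> \<in> words n" and r: "\<mu> \<notin> range (\<lambda>k. replicate k n)"
    and v: "\<nu> = odometer_word n \<mu>" by auto
  obtain k a \<rho> where m: "\<mu> = replicate k n @ a # \<rho>" "a \<noteq> n"
    by (rule list_split_at_first_neq [OF r])
  have "1 \<le> a" "a + 1 \<le> n" "\<rho> \<in> lists {1..n}" using w m by (auto simp: words_def)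
  then have "replicate k 1 @ (a + 1) # \<rho> \<in> words n" "a + 1 \<noteq> 1"
    using replicate_in_words(1) [of n k] by (auto simp: words_def)
  then show "\<nu> \<in> words n - range (\<lambda>k. replicate k 1)"
    using append_neq_notin_replicate [of "a + 1" 1 k \<rho>] m(2)
    unfolding v m(1) odometer_word_split [OF m(2)] by blast
next
  fix \<nu> assume v: "\<nu> \<in> words n - range (\<lambda>k. replicate k 1)"
  then have "\<nu> \<notin> range (\<lambda>k. replicate k 1)" by blast
  then obtain k b \<rho> where m: "\<nu> = replicate k 1 @ b # \<rho>" "b \<noteq> 1"
    by (rule list_split_at_first_neq)
  \<comment> \<open>The truncated subtraction is exact because \<open>b \<ge> 1\<close>; moreover
    \<open>b \<noteq> 1\<close> makes \<open>a\<close> a letter, and \<open>b \<le> n\<close> keeps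
    it different from \<open>n\<close>.\<close>
  define a where "a = b - 1"
  have b: "1 \<le> b" "b \<le> n" "\<rho> \<in> lists {1..n}" using v m by (auto simp: words_def)
  then have ab: "b = a + 1" and a: "a \<noteq> n" "1 \<le> a" "a \<le> n" using m(2) by (auto simp: a_def)
  show "\<nu> \<in> odometer_word n ` (words n - range (\<lambda>k. replicate k n))"
  proof (rule image_eqI)
    show "\<nu> = odometer_word n (replicate k n @ a # \<rho>)"
      using a m ab by (simp add: odometer_word_split)
    have "replicate k n @ a # \<rho> \<in> words n"
      using a b replicate_in_words(2) [of n k] by (auto simp: words_def)
    then show "replicate k n @ a # \<rho> \<in> words n - range (\<lambda>k. replicate k n)"
      using append_neq_notin_replicate [of a n k \<rho>] a by blast
  qed
qed

section \<open>Left tensoring in coordinates\<close>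

lemma coord_left_tensor_append: "coord (left_tensor \<nu> f) (\<nu> @ \<mu>) = coord f \<mu>"
  by (simp add: left_tensor.rep_eq)

lemma left_tensor_Nil [simp]: "left_tensor [] f = f"
  by (rule l2_eqI) (simp add: left_tensor.rep_eq)

text \<open>On powers of one letter, left tensoring is a \<open>p\<close>-fold shift; for the letter
  1 it becomes multiplication by \<open>z ^ p\<close> in the Hardy space.\<close>

lemma coord_left_tensor_replicate:
  "coord (left_tensor (replicate p a) f) (replicate k a) =
    (if p \<le> k then coord f (replicate (k - p) a) else 0)"
proof (cases "p \<le> k")
  case True
  then have "replicate k a = replicate p a @ replicate (k - p) a"
    by (simp flip: replicate_add)
  then show ?thesis using True by (simp only: coord_left_tensor_append if_True)
next
  case False
  then have "length (take p (replicate k a)) \<noteq> p" by simp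
  then have "take p (replicate k a) \<noteq> replicate p a" by (metis length_replicate)
  then show ?thesis using False by (simp add: left_tensor.rep_eq)
qed

section \<open>A triangularity criterion for infinite rank\<close>

text \<open>The kernel of \<open>\<phi> m\<close> contains the images of all later vectors but not
  that of \<open>x m\<close>, so no image lies in the span of later ones.\<close>

lemma infinite_rank_onI:
  assumes S: "\<And>m :: nat. x m \<in> S"
    and nz: "\<And>m. \<phi> m (T (x m)) \<noteq> 0"
    and zero: "\<And>j m. m < j \<Longrightarrow> \<phi> m (T (x j)) = 0"
    and lin: "\<And>m u v. \<phi> m (u + v) = \<phi> m u + \<phi> m v" "\<And>m c u. \<phi> m (c *\<^sub>C u) = c *\<^sub>C \<phi> m u"
  shows "infinite_rank_on S (T :: 'a :: complex_vector \<Rightarrow> 'b :: complex_vector)"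
proof -
  define y where "y m = T (x m)" for m
  have sub: "complex_vector.subspace {u. \<phi> m u = 0}" for m
    using lin(2) [of m 0 0] by (auto simp: complex_vector.subspace_def lin)
  have notin: "y m \<notin> complex_vector.span (y ` {Suc m..N})" for m N
  proof
    assume "y m \<in> complex_vector.span (y ` {Suc m..N})"
    moreover have "complex_vector.span (y ` {Suc m..N}) \<subseteq> {u. \<phi> m u = 0}"
      by (rule complex_vector.span_minimal [OF _ sub]) (auto simp: y_def zero)
    ultimately show False using nz by (auto simp: y_def)
  qed
  \<comment> \<open>Downward induction on \<open>m\<close>: each step inserts \<open>y m\<close> in
    front of the vectors already known to be independent.\<close>
  have ind: "\<not> complex_vector.dependent (y ` {m..N}) \<and> card (y ` {m..N}) = Suc N - m"
    if "m \<le> N" for m N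
    using that
  proof (induction rule: inc_induct)
    case base
    then show ?case using notin [of N N] complex_vector.independent_insert [of "y N" "{}"] by simp
  next
    case (step m)
    have e: "y ` {m..N} = insert (y m) (y ` {Suc m..N})"
      using step by (simp add: atLeastAtMost_insertL [symmetric])
    have "y m \<notin> y ` {Suc m..N}"
      using notin complex_vector.span_base by blast
    then show ?case
      unfolding e using step notin [of m N]
      by (simp add: complex_vector.independent_insert)
  qed
  show ?thesis
    unfolding infinite_rank_on_def
  proof
    assume "\<exists>B. finite B \<and> T ` S \<subseteq> complex_vector.span B"
    then obtain B where B: "finite B" "T ` S \<subseteq> complex_vector.span B" by blast
    \<comment> \<open>This range has \<open>card B + 1\<close> members, one more than the span of
      \<open>B\<close> can hold independently.\<close>
    have "y ` {0..card B} \<subseteq> complex_vector.span B"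
      using B(2) S by (auto simp: y_def)
    then have "card (y ` {0..card B}) \<le> card B"
      using complex_vector.independent_span_bound [OF B(1)] ind [of 0 "card B"] by blast
    then show False using ind [of 0 "card B"] by simp
  qed
qed

section \<open>The Hardy space\<close>

lemma unitary_on_hardy_of_coeffs:
  "unitary_on UNIV UNIV (hardy_of_coeffs :: (nat, 'e :: chilbert_space) l2 \<Rightarrow> 'e hardy2)"
proof (rule unitary_onI)
  show "range (hardy_of_coeffs :: (nat, 'e) l2 \<Rightarrow> 'e hardy2) = UNIV"
    by (rule surjI [where f = taylor]) (rule hardy2_eqI, simp)
qed (auto intro!: hardy2_eqI simp: taylor_add taylor_scaleC cinner_hardy2_def)

section \<open>Szego kernels and point evaluations\<close>

text \<open>The Taylor coefficients in \<open>w\<close> of \<open>x / (1 - cnj z * w)\<close>, the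
  reproducing kernel of the Hardy space. The conjugate matches an inner product that is
  conjugate-linear in its first argument.\<close>

definition szego :: "complex \<Rightarrow> 'e :: chilbert_space \<Rightarrow> (nat, 'e) l2" where
  "szego z x = Abs_l2 (\<lambda>k. cnj z ^ k *\<^sub>C x)"

lemma sums_szego:
  fixes x :: "'e :: complex_normed_vector"
  assumes "cmod z < 1"
  shows "(\<lambda>k. (norm (cnj z ^ k *\<^sub>C x))\<^sup>2) sums ((norm x)\<^sup>2 / (1 - (cmod z)\<^sup>2))"
proof -
  have "(cmod z)\<^sup>2 < 1" using assms by (simp add: power_less_one_iff)
  then have "(\<lambda>k. ((cmod z)\<^sup>2) ^ k * (norm x)\<^sup>2) sums (1 / (1 - (cmod z)\<^sup>2) * (norm x)\<^sup>2)"
    by (intro sums_mult2 geometric_sums) simp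
  then show ?thesis
    by (simp add: norm_power power_mult_distrib mult.commute flip: power_mult)
qed

lemma
  assumes "cmod z < 1"
  shows coord_szego: "coord (szego z x) k = cnj z ^ k *\<^sub>C x"
    and norm_szego: "norm (szego z x) = norm x / sqrt (1 - (cmod z)\<^sup>2)"
proof -
  have s: "((\<lambda>k. (norm (cnj z ^ k *\<^sub>C x))\<^sup>2) has_sum ((norm x)\<^sup>2 / (1 - (cmod z)\<^sup>2))) UNIV"
    by (rule norm_summable_imp_has_sum [OF _ sums_szego [OF assms]])
      (use sums_summable [OF sums_szego [OF assms]] in simp)
  have co: "coord (szego z x) = (\<lambda>k. cnj z ^ k *\<^sub>C x)"
    unfolding szego_def using has_sum_imp_summable [OF s] by (subst Abs_l2_inverse) auto
  then show "coord (szego z x) k = cnj z ^ k *\<^sub>C x" by simp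
  show "norm (szego z x) = norm x / sqrt (1 - (cmod z)\<^sup>2)"
    unfolding norm_l2.rep_eq co infsumI [OF s] by (simp add: real_sqrt_divide)
qed

text \<open>The reproducing property: the conjugated powers leave the first argument as
  \<open>z ^ k\<close>, and pairing with \<open>x\<close> commutes with the power series at
  \<open>z\<close>.\<close>

lemma cinner_szego:
  assumes "cmod z < 1"
  shows "cinner (szego z x) (taylor f) = cinner x (hardy_fun f z)"
proof -
  have bl: "bounded_linear (cinner x)"
  proof (rule bounded_linear_intro [where K = "norm x"])
    fix u v and r :: real
    show "cinner x (u + v) = cinner x u + cinner x v" by (rule cinner_add_right)
    show "cinner x (r *\<^sub>R u) = r *\<^sub>R cinner x u"
      by (simp add: scaleR_scaleC [of r u] cinner_scaleC_right scaleR_conv_of_real)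
    show "norm (cinner x u) \<le> norm u * norm x"
      using cauchy_schwarz [of x u] by (simp add: mult.commute)
  qed
  have "(\<lambda>k. cinner (coord (szego z x) k) (coord (taylor f) k)) summable_on UNIV"
    using coord [of "szego z x"] coord [of "taylor f"] by (intro l2_cinner_summable) auto
  then have "(\<lambda>k. cinner (coord (szego z x) k) (coord (taylor f) k)) sums
      cinner (szego z x) (taylor f)"
    unfolding cinner_l2.rep_eq by (intro has_sum_imp_sums has_sum_infsum)
  moreover have "(\<lambda>k. cinner (coord (szego z x) k) (coord (taylor f) k)) sums
      cinner x (hardy_fun f z)"
    using bounded_linear.sums [OF bl taylor_sums [OF assms, of f]]
    by (simp add: coord_szego [OF assms] cinner_scaleC_left cinner_scaleC_right)
  ultimately show ?thesis by (rule sums_unique2)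
qed

text \<open>Cauchy-Schwarz for the reproducing property, with \<open>x\<close> chosen as the value
  of \<open>f\<close> at \<open>z\<close>. Point evaluations thus are bounded, so identities of
  values can be checked on elementary tensors.\<close>

lemma norm_hardy_fun_le:
  assumes "cmod z < 1"
  shows "norm (hardy_fun f z) \<le> norm f / sqrt (1 - (cmod z)\<^sup>2)"
proof (cases "hardy_fun f z = 0")
  case True
  have "(cmod z)\<^sup>2 < 1" using assms by (simp add: power_less_one_iff)
  then show ?thesis using True by simp
next
  case False
  let ?x = "hardy_fun f z"
  have "(norm ?x)\<^sup>2 = cmod (cinner (szego z ?x) (taylor f))"
    by (simp add: cinner_szego [OF assms] cinner_self norm_power)
  also have "\<dots> \<le> norm (szego z ?x) * norm (taylor f)" by (rule cauchy_schwarz)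
  also have "\<dots> = norm ?x * (norm f / sqrt (1 - (cmod z)\<^sup>2))"
    by (simp add: norm_szego [OF assms] norm_hardy2_def)
  finally have "norm ?x * norm ?x \<le> norm ?x * (norm f / sqrt (1 - (cmod z)\<^sup>2))"
    by (simp only: power2_eq_square [of "norm ?x"])
  then show ?thesis by (rule mult_left_le_imp_le) (simp add: False)
qed

lemma hardy_fun_of_coeffs_sums:
  "cmod z < 1 \<Longrightarrow> (\<lambda>k. z ^ k *\<^sub>C coord a k) sums hardy_fun (hardy_of_coeffs a) z"
  using taylor_sums [of z "hardy_of_coeffs a"] by simp

lemma bounded_linear_scaleC_left:
  "bounded_linear (\<lambda>c :: complex. c *\<^sub>C (x :: 'a :: complex_normed_vector))"
  by (rule bounded_linear_intro [where K = "norm x"])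
    (simp_all add: scaleC_add_left scaleR_scaleC scaleC_scaleC scaleR_conv_of_real)

text \<open>The kernel at its own point is a geometric series with ratio
  \<open>(cmod z)\<^sup>2\<close>. Up to this factor, \<open>x\<close> is recovered as a value of a
  Hardy function.\<close>

lemma hardy_fun_szego:
  assumes "cmod z < 1"
  shows "hardy_fun (hardy_of_coeffs (szego z x)) z = (1 / (1 - (cmod z)\<^sup>2)) *\<^sub>R x"
proof (rule sums_unique2 [OF hardy_fun_of_coeffs_sums [OF assms]])
  have z: "norm (z * cnj z) < 1"
    using assms by (simp add: norm_mult power_less_one_iff flip: power2_eq_square)
  have "(\<lambda>k. (z * cnj z) ^ k *\<^sub>C x) sums ((1 / (1 - z * cnj z)) *\<^sub>C x)"
    by (rule bounded_linear.sums [OF bounded_linear_scaleC_left geometric_sums [OF z]])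
  also have "1 - z * cnj z = complex_of_real (1 - (cmod z)\<^sup>2)"
    by (simp add: complex_mult_cnj cmod_power2)
  finally show "(\<lambda>k. z ^ k *\<^sub>C coord (szego z x) k) sums ((1 / (1 - (cmod z)\<^sup>2)) *\<^sub>R x)"
    by (simp add: coord_szego [OF assms] scaleC_scaleC power_mult_distrib scaleR_scaleC)
qed

section \<open>Operator-valued power series\<close>

lemma summable_powser_scaleC:
  fixes A :: "nat \<Rightarrow> 'a :: {complex_normed_vector, banach}"
  assumes "\<And>r. norm (A r) \<le> K" "cmod z < 1"
  shows "summable (\<lambda>r. z ^ r *\<^sub>C A r)"
proof (rule summable_comparison_test)
  show "summable (\<lambda>r. cmod z ^ r * K)"
    using assms(2) by (intro summable_mult2 summable_geometric) simp
  show "\<exists>N. \<forall>r\<ge>N. norm (z ^ r *\<^sub>C A r) \<le> cmod z ^ r * K"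
    by (auto simp: norm_power intro!: mult_left_mono assms(1))
qed

text \<open>Termwise differentiation, justified by uniform convergence of the derived series on a
  disc around 0 that contains \<open>z\<close>.\<close>

lemma has_derivative_powser_scaleC:
  fixes A :: "nat \<Rightarrow> 'a :: {complex_normed_vector, banach}"
  assumes A: "\<And>r. norm (A r) \<le> K"
    and f: "\<And>z. cmod z < 1 \<Longrightarrow> (\<lambda>r. z ^ r *\<^sub>C A r) sums f z"
    and z: "cmod z < 1"
  shows "\<exists>D. (f has_derivative (\<lambda>h. h *\<^sub>C D)) (at z)"
proof -
  \<comment> \<open>A radius below 1 gives a convergent majorant \<open>M\<close>; the whole unit
    disc need not have one.\<close>
  obtain \<rho> where \<rho>: "cmod z < \<rho>" "\<rho> < 1" using z dense by blast
  then have \<rho>0: "0 < \<rho>" using norm_ge_zero [of z] by linarith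
  define S where "S = ball (0 :: complex) \<rho>"
  \<comment> \<open>For \<open>r = 0\<close> the exponent truncates to 0, but the factor
    \<open>of_nat r\<close> removes the term.\<close>
  define G where "G w = (\<Sum>r. (of_nat r * w ^ (r - 1)) *\<^sub>C A r)" for w :: complex
  define M where "M r = real r * \<rho> ^ (r - 1) * K" for r :: nat
  have K: "0 \<le> K" using A [of 0] norm_ge_zero order_trans by blast
  \<comment> \<open>\<open>diffs\<close> of the constant sequence 1 is \<open>r + 1\<close>, which
    gives the majorant \<open>M\<close> shifted by one index.\<close>
  have "summable (\<lambda>r. diffs (\<lambda>_. 1) r * \<rho> ^ r)"
  proof (rule termdiff_converges [of \<rho> 1])
    show "norm \<rho> < 1" using \<rho> \<rho>0 by simp
    show "summable (\<lambda>n. 1 * x ^ n)" if "norm x < 1" for x :: real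
      using that by (simp add: summable_geometric)
  qed
  then have "summable (\<lambda>r. (1 + real r) * \<rho> ^ r)" by (simp add: diffs_def)
  then have "summable (\<lambda>r. M (Suc r))"
    unfolding M_def by (intro summable_mult2) simp
  then have M: "summable M" by (rule summable_Suc_iff [THEN iffD1])
  have le: "norm ((of_nat r * w ^ (r - 1)) *\<^sub>C A r) \<le> M r" if "w \<in> S" for r w
  proof -
    have "cmod w \<le> \<rho>" using that by (simp add: S_def)
    then show ?thesis
      unfolding M_def by (auto simp: norm_mult norm_power intro!: mult_mono power_mono A K
          mult_nonneg_nonneg zero_le_power less_imp_le [OF \<rho>0])
  qed
  have ul: "uniform_limit S (\<lambda>n w. \<Sum>r<n. (of_nat r * w ^ (r - 1)) *\<^sub>C A r) G sequentially"
    unfolding G_def by (rule Weierstrass_m_test [OF le M])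
  have ex: "\<exists>g. \<forall>w\<in>S. (\<lambda>r. w ^ r *\<^sub>C A r) sums g w \<and>
      (g has_derivative (\<lambda>h. h *\<^sub>C G w)) (at w within S)"
  proof (rule has_derivative_series)
    show "convex S" by (simp add: S_def)
    show "z \<in> S" using \<rho> by (simp add: S_def)
    show "(\<lambda>r. z ^ r *\<^sub>C A r) sums f z" by (rule f [OF z])
    show "((\<lambda>w. w ^ r *\<^sub>C A r) has_derivative (\<lambda>h. h *\<^sub>C (of_nat r * w ^ (r - 1)) *\<^sub>C A r))
        (at w within S)" for r w
    proof -
      have "((\<lambda>w. w ^ r) has_derivative (\<lambda>h. of_nat r * w ^ (r - 1) * h)) (at w within S)"
        by (auto intro!: derivative_eq_intros simp: mult_ac)
      from bounded_linear.has_derivative [OF bounded_linear_scaleC_left this, of "A r"]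
      show ?thesis by (simp add: scaleC_scaleC mult_ac)
    qed
    show "\<forall>\<^sub>F n in sequentially. \<forall>w\<in>S. \<forall>h.
        norm ((\<Sum>i<n. h *\<^sub>C (of_nat i * w ^ (i - 1)) *\<^sub>C A i) - h *\<^sub>C G w) \<le> e * norm h"
      if "e > 0" for e
      using uniform_limitD [OF ul that]
    proof eventually_elim
      case (elim n)
      show ?case
      proof (intro ballI allI)
        fix w h assume "w \<in> S"
        have "(\<Sum>i<n. h *\<^sub>C (of_nat i * w ^ (i - 1)) *\<^sub>C A i) - h *\<^sub>C G w =
            h *\<^sub>C ((\<Sum>i<n. (of_nat i * w ^ (i - 1)) *\<^sub>C A i) - G w)"
          by (simp add: complex_vector.scale_sum_right complex_vector.scale_right_diff_distrib)
        also have "norm \<dots> \<le> e * norm h"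
          using elim \<open>w \<in> S\<close> unfolding norm_scaleC mult.commute [of "cmod h"]
          by (intro mult_right_mono) (auto simp: dist_norm intro: less_imp_le)
        finally show "norm ((\<Sum>i<n. h *\<^sub>C (of_nat i * w ^ (i - 1)) *\<^sub>C A i) - h *\<^sub>C G w)
            \<le> e * norm h" .
      qed
    qed
  qed
  then obtain g where g: "\<And>w. w \<in> S \<Longrightarrow> (\<lambda>r. w ^ r *\<^sub>C A r) sums g w"
    and d: "\<And>w. w \<in> S \<Longrightarrow> (g has_derivative (\<lambda>h. h *\<^sub>C G w)) (at w within S)"
    by blast
  have zS: "z \<in> S" "open S" using \<rho> by (simp_all add: S_def)
  have "g w = f w" if "w \<in> S" for w
    using sums_unique2 [OF g [OF that] f] that \<rho> by (simp add: S_def)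
  moreover have "(g has_derivative (\<lambda>h. h *\<^sub>C G z)) (at z)"
    using d [OF zS(1)] at_within_open [OF zS] by simp
  ultimately have "(f has_derivative (\<lambda>h. h *\<^sub>C G z)) (at z)"
    using zS by (intro has_derivative_transform_within_open [of g _ z UNIV S f]) auto
  then show ?thesis by blast
qed

text \<open>Elements of the type of operators are only real-linear, so complex linearity is carried
  to the limit by evaluating the series at vectors.\<close>

lemma clinear_blinfun_sums:
  fixes A :: "nat \<Rightarrow> 'a :: complex_normed_vector \<Rightarrow>\<^sub>L 'b :: complex_normed_vector"
  assumes "\<And>r. clinear_blinfun (A r)" "A sums B"
  shows "clinear_blinfun B"
  unfolding clinear_blinfun_def
proof (intro allI)
  fix c x
  have s: "(\<lambda>r. blinfun_apply (A r) y) sums blinfun_apply B y" for y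
    by (rule bounded_linear.sums [OF blinfun.bounded_linear_left assms(2)])
  have "(\<lambda>r. blinfun_apply (A r) (c *\<^sub>C x)) sums (c *\<^sub>C blinfun_apply B x)"
    using bounded_linear.sums [OF bounded_linear_scaleC s [of x], of c] assms(1)
    by (simp add: clinear_blinfun_def)
  from sums_unique2 [OF s this]
  show "blinfun_apply B (c *\<^sub>C x) = c *\<^sub>C blinfun_apply B x" .
qed

section \<open>The blocks of the odometer map\<close>

text \<open>A word with exactly \<open>l\<close> leading letters \<open>c\<close> begins with
  \<open>c^j\<close> only if \<open>j \<le> l\<close>. Counting these letters is the source of
  triangularity for the off-diagonal block.\<close>

lemma coord_left_tensor_first_neq:
  assumes "a \<noteq> c"
  shows "coord (left_tensor (replicate j c) f) (replicate l c @ a # \<rho>) =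
    (if j \<le> l then coord f (replicate (l - j) c @ a # \<rho>) else 0)"
proof (cases "j \<le> l")
  case True
  then have "replicate l c @ a # \<rho> = replicate j c @ replicate (l - j) c @ a # \<rho>"
    by (simp flip: replicate_add append_assoc)
  then show ?thesis using True by (simp only: coord_left_tensor_append if_True)
next
  case False
  have "take j (replicate l c @ a # \<rho>) ! l = a" using False by (simp add: nth_append)
  moreover have "replicate j c ! l = c" using False by simp
  ultimately have "take j (replicate l c @ a # \<rho>) \<noteq> replicate j c"
    using assms by metis
  then show ?thesis using False by (simp add: left_tensor.rep_eq)
qed

lemma reindex_ebasis:
  assumes \<tau>: "bij_betw \<tau> A B" and i: "i \<in> A"
  shows "reindex (inv_into A \<tau>) B (ebasis i x) = ebasis (\<tau> i) x"
proof (rule l2_eqI)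
  fix j
  have "inj_on (inv_into A \<tau>) B"
    by (rule bij_betw_imp_inj_on [OF bij_betw_inv_into [OF \<tau>]])
  moreover have "j \<in> B \<and> inv_into A \<tau> j = i \<longleftrightarrow> j = \<tau> i"
    using \<tau> i by (auto simp: bij_betw_def f_inv_into_f)
  ultimately show "coord (reindex (inv_into A \<tau>) B (ebasis i x)) j = coord (ebasis (\<tau> i) x) j"
    by (auto simp: coord_reindex ebasis.rep_eq)
qed

text \<open>A power of a letter is determined by its length, so exchanging letters is injective on
  powers and unitarity follows from the general statement on reindexing.\<close>

lemma shuffle_V_eq_reindex:
  "shuffle_V n = reindex (\<lambda>\<mu>. replicate (length \<mu>) 1) (range (\<lambda>k. replicate k n))"
proof (rule ext, rule l2_eqI)
  fix f :: "(nat list, 'a) l2" and \<mu>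
  have "inj_on (\<lambda>\<mu>. replicate (length \<mu>) (1 :: nat)) (range (\<lambda>k. replicate k n))"
    by (auto simp: inj_on_def)
  moreover have "\<mu> = replicate (length \<mu>) n \<longleftrightarrow> \<mu> \<in> range (\<lambda>k. replicate k n)"
    by auto
  ultimately show "coord (shuffle_V n f) \<mu> =
      coord (reindex (\<lambda>\<mu>. replicate (length \<mu>) 1) (range (\<lambda>k. replicate k n)) f) \<mu>"
    by (simp only: coord_reindex shuffle_V.rep_eq)
qed

lemma unitary_on_shuffle_V:
  assumes "n \<ge> 1"
  shows "unitary_on (space_M_perp n) (space_N_perp n) (shuffle_V n)"
  unfolding space_M_perp_eq [OF assms] space_N_perp_eq [OF assms] shuffle_V_eq_reindex
  by (rule unitary_on_reindex) (auto simp: bij_betw_def inj_on_def image_image)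

text \<open>On \<open>space_M_perp n\<close> this is the unitary that sends \<open>e_1^p\<close>
  tensor \<eta> to the function \<open>z ^ p *\<^sub>C \<eta>\<close>.\<close>

definition hardy_of_fock :: "(nat list, 'e :: chilbert_space) l2 \<Rightarrow> 'e hardy2" where
  "hardy_of_fock f = hardy_of_coeffs (reindex (\<lambda>p. replicate p 1) UNIV f)"

lemma inj_replicate: "inj (\<lambda>p. replicate p c)"
  by (rule injI) (metis length_replicate)

lemma unitary_on_hardy_of_fock:
  assumes "n \<ge> 1"
  shows "unitary_on (space_M_perp n) UNIV (hardy_of_fock :: _ \<Rightarrow> 'e :: chilbert_space hardy2)"
proof -
  have U: "(l2_on UNIV :: (nat, 'e) l2 set) = UNIV" by (simp add: l2_on_def)
  have "bij_betw (\<lambda>p. replicate p (1 :: nat)) UNIV (range (\<lambda>p. replicate p 1))"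
    by (rule inj_on_imp_bij_betw [OF inj_replicate])
  then have "unitary_on (l2_on (range (\<lambda>p. replicate p (1 :: nat)))) (UNIV :: (nat, 'e) l2 set)
      (reindex (\<lambda>p. replicate p 1) UNIV)"
    unfolding U [symmetric] by (rule unitary_on_reindex)
  from unitary_on_compose [OF this unitary_on_hardy_of_coeffs] show ?thesis
    unfolding hardy_of_fock_def [abs_def] space_M_perp_eq [OF assms] .
qed

lemma hardy_of_fock_sums:
  assumes "cmod z < 1"
  shows "(\<lambda>k. z ^ k *\<^sub>C coord f (replicate k 1)) sums hardy_fun (hardy_of_fock f) z"
  using hardy_fun_of_coeffs_sums [OF assms, of "reindex (\<lambda>p. replicate p 1) UNIV f"]
  by (simp add: hardy_of_fock_def coord_reindex [OF inj_replicate])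

lemma bounded_clinear_on_hardy_fun:
  assumes "cmod z < 1"
  shows "bounded_clinear_on UNIV UNIV (\<lambda>f. hardy_fun f z)"
  unfolding bounded_clinear_on_def
  using norm_hardy_fun_le [OF assms]
  by (auto simp: hardy_fun_add hardy_fun_scaleC intro!: exI [of _ "1 / sqrt (1 - (cmod z)\<^sup>2)"])

lemma bounded_clinear_on_blinfun:
  "clinear_blinfun T \<Longrightarrow> bounded_clinear_on UNIV UNIV (blinfun_apply T)"
  unfolding bounded_clinear_on_def clinear_blinfun_def
  by (auto simp: blinfun.add_right intro: norm_blinfun)

lemma bounded_clinear_onD_bounded_linear:
  assumes "bounded_clinear_on UNIV R T"
  shows "bounded_linear T"
proof -
  obtain K where "\<And>x. norm (T x) \<le> K * norm x"
    using assms unfolding bounded_clinear_on_def by blast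
  then show ?thesis
    using assms unfolding bounded_clinear_on_def
    by (intro bounded_linear_intro [where K = K]) (auto simp: scaleR_scaleC mult.commute)
qed

section \<open>The symbol and its coefficients\<close>

text \<open>\<open>Blinfun\<close> can be evaluated once its argument is known to be bounded linear,
  which comes from \<open>L\<close>. Coordinates are contractive, so one bound for \<open>L\<close>
  serves all coefficients.\<close>

lemma
  assumes L: "bounded_clinear_on UNIV R L"
  shows symbol_coeff_apply: "blinfun_apply (symbol_coeff L r) \<eta> = coord (L \<eta>) (replicate r 1)"
    and clinear_symbol_coeff: "clinear_blinfun (symbol_coeff L r)"
    and symbol_coeff_bounded: "\<exists>K. \<forall>r. norm (symbol_coeff L r) \<le> K"
proof -
  have "bounded_clinear_on UNIV UNIV (\<lambda>\<eta>. coord (L \<eta>) (replicate r 1))" for r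
    by (rule bounded_clinear_on_compose [OF L bounded_clinear_on_coord])
  from bounded_linear_Blinfun_apply [OF bounded_clinear_onD_bounded_linear [OF this]]
  have app: "blinfun_apply (symbol_coeff L r) \<eta> = coord (L \<eta>) (replicate r 1)" for r \<eta>
    unfolding symbol_coeff_def by (rule fun_cong)
  then show "blinfun_apply (symbol_coeff L r) \<eta> = coord (L \<eta>) (replicate r 1)" .
  show "clinear_blinfun (symbol_coeff L r)"
    using L by (simp add: clinear_blinfun_def app bounded_clinear_on_def scaleC_l2.rep_eq)
  obtain K where K: "\<And>x. norm (L x) \<le> K * norm x"
    using L unfolding bounded_clinear_on_def by blast
  have "norm (symbol_coeff L r) \<le> \<bar>K\<bar>" for r
  proof (rule norm_blinfun_bound)
    fix \<eta>
    have "norm (coord (L \<eta>) (replicate r 1)) \<le> norm (L \<eta>)" by (rule norm_coord_le)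
    also have "\<dots> \<le> K * norm \<eta>" by (rule K)
    also have "\<dots> \<le> \<bar>K\<bar> * norm \<eta>" by (intro mult_right_mono) auto
    finally show "norm (blinfun_apply (symbol_coeff L r) \<eta>) \<le> \<bar>K\<bar> * norm \<eta>" by (simp add: app)
  qed simp
  then show "\<exists>K. \<forall>r. norm (symbol_coeff L r) \<le> K" by blast
qed

text \<open>The value 0 off the disc is the convention of \<open>hardy_inf\<close>; it turns
  uniqueness on the disc into equality of functions.\<close>

definition symbol :: "('e :: chilbert_space \<Rightarrow> (nat list, 'e) l2) \<Rightarrow> complex \<Rightarrow> 'e \<Rightarrow>\<^sub>L 'e" where
  "symbol L z = (if cmod z < 1 then \<Sum>r. z ^ r *\<^sub>C symbol_coeff L r else 0)"

lemma symbol_sums: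
  assumes "bounded_clinear_on UNIV R L" "cmod z < 1"
  shows "(\<lambda>r. z ^ r *\<^sub>C symbol_coeff L r) sums symbol L z"
proof -
  obtain K where "\<And>r. norm (symbol_coeff L r) \<le> K"
    using symbol_coeff_bounded [OF assms(1)] by blast
  from summable_sums [OF summable_powser_scaleC [OF this assms(2)]]
  show ?thesis using assms(2) by (simp add: symbol_def)
qed

lemma clinear_symbol:
  assumes "bounded_clinear_on UNIV R L" "cmod z < 1"
  shows "clinear_blinfun (symbol L z)"
proof (rule clinear_blinfun_sums [OF _ symbol_sums [OF assms]])
  show "clinear_blinfun (z ^ r *\<^sub>C symbol_coeff L r)" for r
    using clinear_symbol_coeff [OF assms(1), of r]
    by (simp add: clinear_blinfun_def scaleC_blinfun.rep_eq scaleC_scaleC mult.commute)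
qed

lemma symbol_apply_sums:
  assumes "bounded_clinear_on UNIV R L" "cmod z < 1"
  shows "(\<lambda>r. z ^ r *\<^sub>C coord (L \<eta>) (replicate r 1)) sums blinfun_apply (symbol L z) \<eta>"
  using bounded_linear.sums [OF blinfun.bounded_linear_left symbol_sums [OF assms], of \<eta>]
  by (simp add: scaleC_blinfun.rep_eq symbol_coeff_apply [OF assms(1)])

section \<open>The odometer map of a fixed symbol\<close>

locale odometer =
  fixes n :: nat
    and L :: "'e :: chilbert_space \<Rightarrow> (nat list, 'e) l2"
    and W :: "(nat list, 'e) l2 \<Rightarrow> (nat list, 'e) l2"
  assumes n: "n \<ge> 1"
    and L: "bounded_clinear_on UNIV (fock n) L"
    and W: "is_odometer_map n L W"
begin

lemma W_bounded: "bounded_clinear_on (l2_on (words n)) (l2_on (words n)) W"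
  using W by (simp add: is_odometer_map_def fock_eq_l2_on)

text \<open>The case of the vacuum joins the others because left tensoring by the empty word is the
  identity.\<close>

lemma W_replicate: "W (ebasis (replicate m n) \<eta>) = left_tensor (replicate m 1) (L \<eta>)"
  using W by (cases "m = 0") (auto simp: is_odometer_map_def)

lemma W_word:
  "\<mu> \<in> words n - range (\<lambda>k. replicate k n) \<Longrightarrow> W (ebasis \<mu> \<eta>) = ebasis (odometer_word n \<mu>) \<eta>"
  using W unfolding is_odometer_map_def nonconstant_words_eq [symmetric] by blast

lemma space_N_perp_subset: "space_N_perp n \<subseteq> l2_on (words n)"
  by (auto simp: space_N_perp_def ocomplement_def fock_eq_l2_on)

text \<open>On elementary tensors of \<open>space_N n\<close>, \<open>W\<close> agrees with the
  unitary reindexing along the odometer bijection, hence on all of \<open>space_N n\<close> by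
  boundedness.\<close>

lemma unitary_on_W: "unitary_on (space_N n) (space_M n) W"
proof -
  let ?A = "words n - range (\<lambda>k. replicate k n)" and ?B = "words n - range (\<lambda>k. replicate k 1)"
  let ?R = "reindex (inv_into ?A (odometer_word n)) ?B"
  have u: "unitary_on (l2_on ?A) (l2_on ?B) ?R"
    by (rule unitary_on_reindex [OF bij_betw_inv_into [OF odometer_word_bij]])
  have "W f = ?R f" if "f \<in> l2_on ?A" for f
  proof (rule bounded_clinear_on_l2_eqI [OF _ _ _ that])
    show "bounded_clinear_on (l2_on ?A) (l2_on (words n)) W"
      by (rule bounded_clinear_on_subset [OF W_bounded]) (auto simp: l2_on_def)
    show "bounded_clinear_on (l2_on ?A) (l2_on ?B) ?R"
      by (rule unitary_on_bounded [OF u])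
    show "W (ebasis i x) = ?R (ebasis i x)" if "i \<in> ?A" for i x
      by (simp only: W_word [OF that] reindex_ebasis [OF odometer_word_bij that])
  qed
  then show ?thesis
    unfolding space_M_eq space_N_eq by (rule unitary_on_cong [OF u subspace_l2_on])
qed

lemma bounded_clinear_on_compression:
  "bounded_clinear_on (space_N_perp n) (l2_on A) (\<lambda>f. l2_restrict A (W f))"
  by (rule bounded_clinear_on_compose [OF bounded_clinear_on_subset [OF W_bounded space_N_perp_subset order_refl]
        bounded_clinear_on_l2_restrict])

lemma W12_zero_or_infinite_rank:
  "(\<forall>f\<in>space_N_perp n. orth_proj (space_M n) (W f) = 0) \<or>
    infinite_rank_on (space_N_perp n) (\<lambda>f. orth_proj (space_M n) (W f))"
proof -
  let ?B = "words n - range (\<lambda>k. replicate k 1)"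
  have proj: "orth_proj (space_M n) f = l2_restrict ?B f" for f :: "(nat list, 'e) l2"
    by (simp only: space_M_eq orth_proj_l2_on)
  \<comment> \<open>\<open>P k \<eta>\<close> says that the component of \<open>L \<eta>\<close> in
    \<open>space_M n\<close> has a nonzero coordinate at a word with exactly \<open>k\<close>
    leading letters 1.\<close>
  define P where "P k \<eta> \<longleftrightarrow> (\<exists>a \<rho>. a \<noteq> 1 \<and> coord (L \<eta>) (replicate k 1 @ a # \<rho>) \<noteq> 0)" for k \<eta>
  show ?thesis
  proof (cases "\<exists>k \<eta>. P k \<eta>")
    case True
    then obtain \<eta> where ex: "\<exists>k. P k \<eta>" by blast
    \<comment> \<open>Minimality of \<open>k\<close> makes the coordinates at
      \<open>1^i a \<rho>\<close> vanish for all \<open>i < k\<close>, which supplies the zeros of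
      the triangular system.\<close>
    define k where "k = (LEAST k. P k \<eta>)"
    have "P k \<eta>" unfolding k_def by (rule LeastI_ex [OF ex])
    then obtain a \<rho> where a: "a \<noteq> 1" and nz: "coord (L \<eta>) (replicate k 1 @ a # \<rho>) \<noteq> 0"
      by (auto simp: P_def)
    have least: "coord (L \<eta>) (replicate i 1 @ a # \<rho>) = 0" if "i < k" for i
      using not_less_Least [of i "\<lambda>k. P k \<eta>"] that a by (auto simp: k_def P_def)
    have "L \<eta> \<in> fock n" using L by (simp add: bounded_clinear_on_def)
    then have w: "replicate k 1 @ a # \<rho> \<in> words n" using nz by (auto simp: fock_def)
    have inB: "replicate (m + k) 1 @ a # \<rho> \<in> ?B" for m
      using w replicate_in_words(1) [OF n, of "m + k"] append_neq_notin_replicate [OF a]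
      by (auto simp: words_def simp del: One_nat_def)
    have co: "coord (l2_restrict ?B (W (ebasis (replicate j n) \<eta>))) (replicate (m + k) 1 @ a # \<rho>) =
        (if j \<le> m + k then coord (L \<eta>) (replicate (m + k - j) 1 @ a # \<rho>) else 0)" for m j
      using inB [of m] by (simp only: l2_restrict.rep_eq W_replicate coord_left_tensor_first_neq [OF a] if_True)
    have "infinite_rank_on (space_N_perp n) (\<lambda>f. l2_restrict ?B (W f))"
    proof (rule infinite_rank_onI)
      show "ebasis (replicate m n) \<eta> \<in> space_N_perp n" for m
        unfolding space_N_perp_eq [OF n] by (rule ebasis_in_l2_on) blast
      show "coord (l2_restrict ?B (W (ebasis (replicate m n) \<eta>))) (replicate (m + k) 1 @ a # \<rho>) \<noteq> 0" for m
        unfolding co using nz by simp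
      show "coord (l2_restrict ?B (W (ebasis (replicate j n) \<eta>))) (replicate (m + k) 1 @ a # \<rho>) = 0"
        if "m < j" for m j
        \<comment> \<open>For \<open>j > m\<close>, either \<open>j > m + k\<close> and the prefix
          does not fit, or \<open>m + k - j < k\<close> and minimality applies.\<close>
        unfolding co using least [of "m + k - j"] that by simp
    qed (simp_all add: plus_l2.rep_eq scaleC_l2.rep_eq)
    then show ?thesis by (simp only: proj simp_thms)
  next
    case False
    have "l2_restrict ?B (W f) = 0" if "f \<in> l2_on (range (\<lambda>k. replicate k n))" for f
    proof (rule bounded_clinear_on_l2_eqI [OF _ _ _ that])
      show "bounded_clinear_on (l2_on (range (\<lambda>k. replicate k n))) (l2_on ?B) (\<lambda>f. l2_restrict ?B (W f))"
        using bounded_clinear_on_compression [of ?B] by (simp only: space_N_perp_eq [OF n])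
      show "bounded_clinear_on (l2_on (range (\<lambda>k. replicate k n))) UNIV (\<lambda>f. 0)"
        by (auto simp: bounded_clinear_on_def intro!: exI [of _ 0])
      fix i \<eta> assume "i \<in> range (\<lambda>k. replicate k n)"
      then obtain m where i: "i = replicate m n" by blast
      show "l2_restrict ?B (W (ebasis i \<eta>)) = 0"
      proof (rule l2_eqI)
        fix \<mu>
        show "coord (l2_restrict ?B (W (ebasis i \<eta>))) \<mu> = coord 0 \<mu>"
        proof (cases "\<mu> \<in> ?B")
          case True
          then have "\<mu> \<notin> range (\<lambda>k. replicate k 1)" by blast
          then obtain k a \<rho> where \<mu>: "\<mu> = replicate k 1 @ a # \<rho>" and a: "a \<noteq> 1"
            by (rule list_split_at_first_neq)
          then show ?thesis
            using False True unfolding \<mu> i l2_restrict.rep_eq W_replicate coord_left_tensor_first_neq [OF a]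
            by (auto simp: P_def zero_l2.rep_eq)
        next
          case False
          then show ?thesis by (simp only: l2_restrict.rep_eq zero_l2.rep_eq if_False)
        qed
      qed
    qed
    then show ?thesis by (simp only: proj space_N_perp_eq [OF n]) blast
  qed
qed

definition toeplitz :: "(nat list, 'e) l2 \<Rightarrow> (nat list, 'e) l2" where
  "toeplitz f = orth_proj (space_M_perp n) (W (shuffle_V n f))"

lemma toeplitz_eq: "toeplitz f = l2_restrict (range (\<lambda>k. replicate k 1)) (W (shuffle_V n f))"
  by (simp only: toeplitz_def space_M_perp_eq [OF n] orth_proj_l2_on)

lemma bounded_clinear_on_toeplitz:
  "bounded_clinear_on (space_M_perp n) (space_M_perp n) toeplitz"
proof -
  have "bounded_clinear_on (space_M_perp n) (space_N_perp n :: (nat list, 'e) l2 set) (shuffle_V n)"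
    by (rule unitary_on_bounded [OF unitary_on_shuffle_V [OF n]])
  from bounded_clinear_on_compose [OF this bounded_clinear_on_compression]
  show ?thesis by (simp only: toeplitz_eq [abs_def] space_M_perp_eq [OF n])
qed

text \<open>For fixed \<open>z\<close> both sides are bounded linear in \<open>f\<close>, and on
  \<open>e_1^p\<close> tensor \<eta> both equal \<open>z ^ p\<close> times the symbol applied to
  \<eta>. Working at one point avoids any boundedness of the symbol over the disc, which is deduced
  from this identity.\<close>

lemma hardy_fun_toeplitz:
  assumes f: "f \<in> space_M_perp n" and z: "cmod z < 1"
  shows "hardy_fun (hardy_of_fock (toeplitz f)) z =
    blinfun_apply (symbol L z) (hardy_fun (hardy_of_fock f) z)"
proof (rule bounded_clinear_on_l2_eqI [OF _ _ _ f [unfolded space_M_perp_eq [OF n]]])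
  have U: "bounded_clinear_on (space_M_perp n) UNIV (\<lambda>f. hardy_fun (hardy_of_fock f :: 'e hardy2) z)"
    by (rule bounded_clinear_on_compose [OF unitary_on_bounded [OF unitary_on_hardy_of_fock [OF n]]
          bounded_clinear_on_hardy_fun [OF z]])
  show "bounded_clinear_on (l2_on (range (\<lambda>k. replicate k 1))) UNIV
      (\<lambda>f. hardy_fun (hardy_of_fock (toeplitz f)) z)"
    using bounded_clinear_on_compose [OF bounded_clinear_on_toeplitz U]
    by (simp only: space_M_perp_eq [OF n])
  show "bounded_clinear_on (l2_on (range (\<lambda>k. replicate k 1))) UNIV
      (\<lambda>f. blinfun_apply (symbol L z) (hardy_fun (hardy_of_fock f) z))"
    using bounded_clinear_on_compose [OF U bounded_clinear_on_blinfun [OF clinear_symbol [OF L z]]]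
    by (simp only: space_M_perp_eq [OF n])
  fix i and \<eta> :: 'e assume "i \<in> range (\<lambda>k. replicate k (1 :: nat))"
  then obtain p where i: "i = replicate p 1" by blast
  have "(\<lambda>k. z ^ k *\<^sub>C coord (ebasis i \<eta>) (replicate k 1)) sums (z ^ p *\<^sub>C \<eta>)"
    using sums_single [of p "\<lambda>k. z ^ k *\<^sub>C \<eta>"]
    by (rule back_subst [of "\<lambda>f. f sums _"]) (auto simp: i ebasis.rep_eq fun_eq_iff)
  then have e: "hardy_fun (hardy_of_fock (ebasis i \<eta>)) z = z ^ p *\<^sub>C \<eta>"
    by (rule sums_unique2 [OF hardy_of_fock_sums [OF z]])
  have T: "toeplitz (ebasis i \<eta>) = l2_restrict (range (\<lambda>k. replicate k 1))
      (left_tensor (replicate p 1) (L \<eta>))"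
    by (simp only: toeplitz_eq i shuffle_V_ebasis W_replicate)
  define c where "c k = z ^ k *\<^sub>C coord (toeplitz (ebasis i \<eta>)) (replicate k 1)" for k
  have c: "c k = (if p \<le> k then z ^ k *\<^sub>C coord (L \<eta>) (replicate (k - p) 1) else 0)" for k
  proof -
    have "replicate k (1 :: nat) \<in> range (\<lambda>k. replicate k 1)" by blast
    then show ?thesis
      by (simp add: c_def T l2_restrict.rep_eq coord_left_tensor_replicate del: One_nat_def)
  qed
  have "(\<lambda>r. z ^ p *\<^sub>C z ^ r *\<^sub>C coord (L \<eta>) (replicate r 1)) sums
      (z ^ p *\<^sub>C blinfun_apply (symbol L z) \<eta>)"
    by (rule bounded_linear.sums [OF bounded_linear_scaleC symbol_apply_sums [OF L z]])
  then have "(\<lambda>r. c (r + p)) sums (z ^ p *\<^sub>C blinfun_apply (symbol L z) \<eta>)"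
    by (simp add: c scaleC_scaleC power_add mult.commute)
  \<comment> \<open>The coefficients below \<open>p\<close> vanish, so the series starting at
    \<open>p\<close> is the full one.\<close>
  then have "c sums (z ^ p *\<^sub>C blinfun_apply (symbol L z) \<eta>)"
    by (subst (asm) sums_zero_iff_shift) (auto simp: c)
  then have "hardy_fun (hardy_of_fock (toeplitz (ebasis i \<eta>))) z = z ^ p *\<^sub>C blinfun_apply (symbol L z) \<eta>"
    unfolding c_def by (rule sums_unique2 [OF hardy_of_fock_sums [OF z]])
  then show "hardy_fun (hardy_of_fock (toeplitz (ebasis i \<eta>))) z =
      blinfun_apply (symbol L z) (hardy_fun (hardy_of_fock (ebasis i \<eta>)) z)"
    using clinear_symbol [OF L z] by (simp add: e clinear_blinfun_def)
qed

text \<open>Testing the Toeplitz operator on the Szego kernel at \<open>z\<close> bounds \<open>symbol L z\<close> without any use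
  of adjoints.\<close>

lemma symbol_bounded: "\<exists>K. \<forall>z. cmod z < 1 \<longrightarrow> norm (symbol L z) \<le> K"
proof -
  obtain K where K: "\<And>f. f \<in> space_M_perp n \<Longrightarrow> norm (toeplitz f) \<le> K * norm f"
    using bounded_clinear_on_toeplitz unfolding bounded_clinear_on_def by blast
  note U = unitary_on_hardy_of_fock [OF n, where ?'e = 'e]
  have "norm (symbol L z) \<le> \<bar>K\<bar>" if z: "cmod z < 1" for z
  proof (rule norm_blinfun_bound)
    fix \<eta> :: 'e
    define s where "s = 1 - (cmod z)\<^sup>2"
    have s: "s > 0" using z by (simp add: s_def power_less_one_iff)
    \<comment> \<open>The unitary onto the Hardy space is surjective, so the kernel function has a
      preimage to test on.\<close>
    obtain f where f: "f \<in> space_M_perp n" and Uf: "hardy_of_fock f = hardy_of_coeffs (szego z \<eta>)"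
      using U unfolding unitary_on_def by (metis UNIV_I imageE)
    have Tf: "toeplitz f \<in> space_M_perp n"
      using bounded_clinear_on_toeplitz f by (simp add: bounded_clinear_on_def)
    have "norm f = norm (hardy_of_fock f)" using unitary_on_norm [OF U f] by simp
    also have "\<dots> = norm \<eta> / sqrt s"
      unfolding Uf by (simp add: norm_hardy2_def norm_szego [OF z] s_def)
    finally have nf: "norm f = norm \<eta> / sqrt s" .
    have "blinfun_apply (symbol L z) ((1 / s) *\<^sub>R \<eta>) = hardy_fun (hardy_of_fock (toeplitz f)) z"
      by (simp only: hardy_fun_toeplitz [OF f z] Uf hardy_fun_szego [OF z] s_def)
    from arg_cong [where f = norm, OF this]
    have "(1 / s) * norm (blinfun_apply (symbol L z) \<eta>) =
        norm (hardy_fun (hardy_of_fock (toeplitz f)) z)"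
      using s by (simp add: blinfun.scaleR_right)
    also have "\<dots> \<le> norm (toeplitz f) / sqrt s"
      using norm_hardy_fun_le [OF z, of "hardy_of_fock (toeplitz f)"] unitary_on_norm [OF U Tf]
      by (simp add: s_def)
    also have "\<dots> \<le> \<bar>K\<bar> * norm f / sqrt s"
    proof (rule divide_right_mono)
      have "norm (toeplitz f) \<le> K * norm f" by (rule K [OF f])
      also have "\<dots> \<le> \<bar>K\<bar> * norm f" by (intro mult_right_mono) auto
      finally show "norm (toeplitz f) \<le> \<bar>K\<bar> * norm f" .
    qed (use s in simp)
    \<comment> \<open>One factor \<open>1 / sqrt s\<close> comes from the norm of the kernel and one
      from point evaluation; together they cancel the value \<open>1 / s\<close> of the kernel at
      its own point.\<close>
    also have "\<dots> = (1 / s) * (\<bar>K\<bar> * norm \<eta>)"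
      using s by (simp add: nf)
    finally show "norm (blinfun_apply (symbol L z) \<eta>) \<le> \<bar>K\<bar> * norm \<eta>"
      using s by (simp add: mult_le_cancel_left divide_le_cancel)
  qed simp
  then show ?thesis by blast
qed

lemma symbol_in_hardy_inf: "symbol L \<in> hardy_inf"
proof -
  obtain K where K: "\<And>r. norm (symbol_coeff L r) \<le> K"
    using symbol_coeff_bounded [OF L] by blast
  have "\<exists>D. (symbol L has_derivative (\<lambda>h. h *\<^sub>C D)) (at z)" if "cmod z < 1" for z
    by (rule has_derivative_powser_scaleC [OF K symbol_sums [OF L] that])
  then show ?thesis
    unfolding hardy_inf_def using symbol_bounded clinear_symbol [OF L] by (simp add: symbol_def)
qed

text \<open>The pointwise product is the function of \<open>hardy_of_fock (toeplitz f)\<close>, with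
  both sides 0 off the disc. It therefore lies in the Hardy space, and \<open>Abs_hardy2\<close> in
  \<open>mult_op\<close> can be inverted.\<close>

lemma unitarily_equivalent_toeplitz:
  "unitarily_equivalent (space_M_perp n) toeplitz UNIV (mult_op (symbol L))"
proof -
  have "hardy_of_fock (toeplitz f) = mult_op (symbol L) (hardy_of_fock f)"
    if f: "f \<in> space_M_perp n" for f
  proof -
    have "hardy_fun (hardy_of_fock (toeplitz f)) z =
        blinfun_apply (symbol L z) (hardy_fun (hardy_of_fock f) z)" for z
      using hardy_fun_toeplitz [OF f, of z] by (cases "cmod z < 1") (auto simp: hardy_fun_outside)
    then have "mult_op (symbol L) (hardy_of_fock f) =
        Abs_hardy2 (hardy_fun (hardy_of_fock (toeplitz f)))"
      unfolding mult_op_def by presburger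
    then show ?thesis by (simp add: hardy_fun_inverse)
  qed
  then show ?thesis
    unfolding unitarily_equivalent_def using unitary_on_hardy_of_fock [OF n] by blast
qed

end

section \<open>Block decomposition and uniqueness of the symbol\<close>

theorem theorem3p8:
  fixes n :: nat
    and L :: "'e :: chilbert_space \<Rightarrow> (nat list, 'e) l2"
    and W :: "(nat list, 'e) l2 \<Rightarrow> (nat list, 'e) l2"
  assumes n: "n \<ge> 1"
    and separable: "separable_space (euclidean :: 'e topology)"
    and L: "bounded_clinear_on UNIV (fock n) L"
    and W: "is_odometer_map n L W"
  defines "W12 \<equiv> \<lambda>f. orth_proj (space_M n) (W f)"
    and "W22 \<equiv> \<lambda>f. orth_proj (space_M_perp n) (W f)"
  shows "orth_decomposition (fock n :: (nat list, 'e) l2 set) (space_N n) (space_N_perp n) \<and>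
    orth_decomposition (fock n :: (nat list, 'e) l2 set) (space_M n) (space_M_perp n) \<and>
    block_decomposition (space_N n) (space_N_perp n) (space_M n) (space_M_perp n) W
      W         W12
      (\<lambda>_. 0)  W22 \<and>
    unitary_on (space_N n) (space_M n) W \<and>
    ((\<forall>f\<in>space_N_perp n. W12 f = 0) \<or> infinite_rank_on (space_N_perp n) W12) \<and>
    bounded_clinear_on (space_M_perp n) (space_M_perp n) (W22 \<circ> shuffle_V n) \<and>
    (\<exists>!\<Theta>. \<Theta> \<in> hardy_inf \<and>
       (\<forall>z. cmod z < 1 \<longrightarrow> (\<lambda>r. z ^ r *\<^sub>C symbol_coeff L r) sums \<Theta> z) \<and>
       unitarily_equivalent (space_M_perp n) (W22 \<circ> shuffle_V n)
         (UNIV :: 'e hardy2 set) (mult_op \<Theta>))"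
proof -
  interpret odometer n L W by (rule odometer.intro [OF n L W])
  let ?A = "\<lambda>c. words n - range (\<lambda>k. replicate k c)" and ?R = "\<lambda>c. range (\<lambda>k. replicate k c)"
  have split: "words n = ?A 1 \<union> ?R 1" "words n = ?A n \<union> ?R n"
    using replicate_in_words [OF n] by blast+
  have dec: "orth_decomposition (fock n :: (nat list, 'e) l2 set) (space_N n) (space_N_perp n)"
    "orth_decomposition (fock n :: (nat list, 'e) l2 set) (space_M n) (space_M_perp n)"
    unfolding space_N_eq space_N_perp_eq [OF n] space_M_eq space_M_perp_eq [OF n] fock_eq_l2_on
    using orth_decomposition_l2_on [of "?A 1" "?R 1", where ?'e = 'e]
      orth_decomposition_l2_on [of "?A n" "?R n", where ?'e = 'e]
    unfolding split [symmetric] by blast+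
  have W12: "W12 f = l2_restrict (?A 1) (W f)" and W22: "W22 f = l2_restrict (?R 1) (W f)" for f
    by (simp_all only: W12_def W22_def space_M_eq space_M_perp_eq [OF n] orth_proj_l2_on)
  \<comment> \<open>\<open>W x\<close> already lies in \<open>space_M n\<close>, whence the zero
    block; only \<open>W y\<close> has to be split.\<close>
  have "W (x + y) = (W x + W12 y) + (0 + W22 y)"
    if x: "x \<in> space_N n" and y: "y \<in> space_N_perp n" for x y
  proof -
    have mem: "x \<in> l2_on (words n)" "y \<in> l2_on (words n)"
      using x y space_N_perp_subset by (auto simp: space_N_eq l2_on_def)
    then have "W y \<in> l2_on (?A 1 \<union> ?R 1)"
      using W_bounded unfolding split(1) [symmetric] by (simp add: bounded_clinear_on_def)
    from l2_restrict_l2_on_sum [OF this] have "W y = W12 y + W22 y"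
      unfolding W12 W22 by blast
    then show ?thesis using W_bounded mem by (simp add: bounded_clinear_on_def add.assoc)
  qed
  moreover have "bounded_clinear_on (space_N n) (space_M n) W"
    by (rule unitary_on_bounded [OF unitary_on_W])
  moreover have "bounded_clinear_on (space_N_perp n) (space_M n) W12"
    unfolding W12 [abs_def] space_M_eq by (rule bounded_clinear_on_compression)
  moreover have "bounded_clinear_on (space_N_perp n) (space_M_perp n) W22"
    unfolding W22 [abs_def] space_M_perp_eq [OF n] by (rule bounded_clinear_on_compression)
  moreover have "bounded_clinear_on (space_N n) (space_M_perp n :: (nat list, 'e) l2 set)
      (\<lambda>_ :: (nat list, 'e) l2. 0)"
    by (auto simp: bounded_clinear_on_def space_M_perp_eq [OF n]
        complex_vector.subspace_0 [OF subspace_l2_on] intro!: exI [of _ 0])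
  ultimately have block: "block_decomposition (space_N n) (space_N_perp n) (space_M n) (space_M_perp n) W
      W W12 (\<lambda>_. 0) W22"
    unfolding block_decomposition_def by blast
  have T: "W22 \<circ> shuffle_V n = toeplitz" by (auto simp: W22_def toeplitz_def)
  have "\<exists>!\<Theta>. \<Theta> \<in> hardy_inf \<and>
       (\<forall>z. cmod z < 1 \<longrightarrow> (\<lambda>r. z ^ r *\<^sub>C symbol_coeff L r) sums \<Theta> z) \<and>
       unitarily_equivalent (space_M_perp n) toeplitz (UNIV :: 'e hardy2 set) (mult_op \<Theta>)"
  proof (rule ex1I [of _ "symbol L"])
    show "symbol L \<in> hardy_inf \<and>
       (\<forall>z. cmod z < 1 \<longrightarrow> (\<lambda>r. z ^ r *\<^sub>C symbol_coeff L r) sums symbol L z) \<and>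
       unitarily_equivalent (space_M_perp n) toeplitz (UNIV :: 'e hardy2 set) (mult_op (symbol L))"
      using symbol_in_hardy_inf symbol_sums [OF L] unitarily_equivalent_toeplitz by blast
    fix \<Theta> assume \<Theta>: "\<Theta> \<in> hardy_inf \<and>
       (\<forall>z. cmod z < 1 \<longrightarrow> (\<lambda>r. z ^ r *\<^sub>C symbol_coeff L r) sums \<Theta> z) \<and>
       unitarily_equivalent (space_M_perp n) toeplitz (UNIV :: 'e hardy2 set) (mult_op \<Theta>)"
    \<comment> \<open>Inside the disc the series determines the value; outside it
      \<open>hardy_inf\<close> forces 0.\<close>
    show "\<Theta> = symbol L"
    proof
      fix z show "\<Theta> z = symbol L z"
      proof (cases "cmod z < 1")
        case True
        then show ?thesis using \<Theta> sums_unique2 [OF _ symbol_sums [OF L True]] by blast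
      next
        case False
        then show ?thesis using \<Theta> by (simp add: hardy_inf_def symbol_def)
      qed
    qed
  qed
  then show ?thesis
    using dec block unitary_on_W W12_zero_or_infinite_rank bounded_clinear_on_toeplitz
    unfolding T W12_def by blast
qed

end
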